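(* The $k$-Anonymity problem can be approximated within factor $m$ in polynomial time (for all values of $k$): there is a polynomial-time algorithm that, given a table with $m$ quasi-identifier columns and an integer $k$, outputs a partition in which every group has at least $k$ rows and whose cost is at most $m$ times the minimum cost of such a partition.
   Context: A table $\mathcal{T}$ with $m$ quasi-identifier attributes is a multiset of $n$ rows in $\Sigma^{m}$, $\Sigma$ a finite alphabet. For a nonempty group $M\subseteq\mathcal{T}$, its suppression cost is $|M|$ times the number of coordinates on which not all rows of $M$ agree; the cost of a partition of $\mathcal{T}$ into nonempty groups is the sum of its groups' costs. The $k$-Anonymity problem: given $\mathcal{T}$ and $k$ (with $k\le n$), find a partition of $\mathcal{T}$ in which every group has at least $k$ rows, of minimum cost. *)

theory Defs
  imports
    Complex_Main
    "HOL-Library.Multiset"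
    "HOL-Library.Discrete_Functions"
    "HOL-Computational_Algebra.Polynomial"
begin

section \<open>Tables and k-anonymous partitions\<close>

type_synonym 'a row = "'a list"

definition table :: "'a set \<Rightarrow> nat \<Rightarrow> 'a row multiset \<Rightarrow> bool" where
  "table \<Sigma> m T \<longleftrightarrow> finite \<Sigma> \<and> (\<forall>r\<in>#T. length r = m \<and> set r \<subseteq> \<Sigma>)"

definition suppressed_columns :: "nat \<Rightarrow> 'a row multiset \<Rightarrow> nat set" where
  "suppressed_columns m M = {j. j < m \<and> \<not> (\<forall>r\<in>#M. \<forall>r'\<in>#M. r ! j = r' ! j)}"

definition group_cost :: "nat \<Rightarrow> 'a row multiset \<Rightarrow> nat" where
  "group_cost m M = size M * card (suppressed_columns m M)"

definition table_partition :: "'a row multiset \<Rightarrow> 'a row multiset multiset \<Rightarrow> bool" where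
  "table_partition T P \<longleftrightarrow> \<Sum>\<^sub># P = T \<and> {#} \<notin># P"

definition partition_cost :: "nat \<Rightarrow> 'a row multiset multiset \<Rightarrow> nat" where
  "partition_cost m P = (\<Sum>M\<in>#P. group_cost m M)"

definition k_anonymous_partition ::
    "nat \<Rightarrow> 'a row multiset \<Rightarrow> 'a row multiset multiset \<Rightarrow> bool" where
  "k_anonymous_partition k T P \<longleftrightarrow> table_partition T P \<and> (\<forall>M\<in>#P. k \<le> size M)"

definition min_cost :: "nat \<Rightarrow> nat \<Rightarrow> 'a row multiset \<Rightarrow> nat" where
  "min_cost m k T = (LEAST c. \<exists>P. k_anonymous_partition k T P \<and> partition_cost m P = c)"

lemma min_cost_attained:
  assumes "k \<le> size T"
  shows "\<exists>P. k_anonymous_partition k T P \<and> partition_cost m P = min_cost m k T"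
proof -
  have "\<exists>P. k_anonymous_partition k T P"
  proof (cases "T = {#}")
    case True
    then have "k_anonymous_partition k T {#}"
      by (simp add: k_anonymous_partition_def table_partition_def)
    then show ?thesis ..
  next
    case False
    with assms have "k_anonymous_partition k T {#T#}"
      by (simp add: k_anonymous_partition_def table_partition_def)
    then show ?thesis ..
  qed
  then have "\<exists>c P. k_anonymous_partition k T P \<and> partition_cost m P = c"
    by blast
  then show ?thesis
    unfolding min_cost_def by (rule LeastI_ex)
qed

lemma min_cost_le: "k_anonymous_partition k T P \<Longrightarrow> min_cost m k T \<le> partition_cost m P"
  unfolding min_cost_def by (rule Least_le) blast


section \<open>Random access machines with logarithmic cost\<close>

text \<open>
  Polynomial time is measured on a random access machine with natural-number registers and
  memory cells, programmed by structured commands, under the logarithmic cost criterion (Aho,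
  Hopcroft and Ullman): every evaluated subexpression is charged the length of its value in
  binary.  Since addresses are themselves subexpressions, a memory access pays for the address
  and for the contents, and a product pays for both of its factors.  Under this criterion such
  machines and multi-tape Turing machines simulate each other with polynomial overhead.
\<close>

text \<open>
  The number of binary digits of \<open>n\<close>, with length 1 for zero.
\<close>

definition bit_length :: "nat \<Rightarrow> nat" where
  "bit_length n = floor_log n + 1"

datatype aexp =
    Const nat
  | Reg nat
  | Mem aexp
  | Add aexp aexp
  | Sub aexp aexp
  | Mult aexp aexp

text \<open>
  \<open>If e c d\<close> and \<open>While e c\<close> test whether the value of \<open>e\<close> is nonzero.
\<close>

datatype com =
    Skip
  | Assign nat aexp
  | Store aexp aexp
  | Seq com com
  | If aexp com com
  | While aexp com

text \<open>
  A state consists of the register contents and the memory contents.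
\<close>

type_synonym state = "(nat \<Rightarrow> nat) \<times> (nat \<Rightarrow> nat)"

text \<open>
  Subtraction is truncated at zero, as it is on type \<open>nat\<close>.
\<close>

primrec aval :: "aexp \<Rightarrow> state \<Rightarrow> nat" where
  "aval (Const n) s = n"
| "aval (Reg i) s = fst s i"
| "aval (Mem a) s = snd s (aval a s)"
| "aval (Add a b) s = aval a s + aval b s"
| "aval (Sub a b) s = aval a s - aval b s"
| "aval (Mult a b) s = aval a s * aval b s"

primrec acost :: "aexp \<Rightarrow> state \<Rightarrow> nat" where
  "acost (Const n) s = bit_length n"
| "acost (Reg i) s = bit_length (fst s i)"
| "acost (Mem a) s = acost a s + bit_length (aval (Mem a) s)"
| "acost (Add a b) s = acost a s + acost b s + bit_length (aval (Add a b) s)"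
| "acost (Sub a b) s = acost a s + acost b s + bit_length (aval (Sub a b) s)"
| "acost (Mult a b) s = acost a s + acost b s + bit_length (aval (Mult a b) s)"

text \<open>
  \<open>exec c s t s'\<close>: started in state \<open>s\<close>, command \<open>c\<close> halts in state \<open>s'\<close> at total cost \<open>t\<close>.
\<close>

inductive exec :: "com \<Rightarrow> state \<Rightarrow> nat \<Rightarrow> state \<Rightarrow> bool" where
  Skip: "exec Skip s 1 s"
| Assign: "exec (Assign i e) s (1 + acost e s) ((fst s)(i := aval e s), snd s)"
| Store: "exec (Store a e) s (1 + acost a s + acost e s)
            (fst s, (snd s)(aval a s := aval e s))"
| Seq: "exec c s t s' \<Longrightarrow> exec d s' t' s'' \<Longrightarrow> exec (Seq c d) s (t + t') s''"
| IfTrue: "aval e s \<noteq> 0 \<Longrightarrow> exec c s t s' \<Longrightarrow> exec (If e c d) s (1 + acost e s + t) s'"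
| IfFalse: "aval e s = 0 \<Longrightarrow> exec d s t s' \<Longrightarrow> exec (If e c d) s (1 + acost e s + t) s'"
| WhileFalse: "aval e s = 0 \<Longrightarrow> exec (While e c) s (1 + acost e s) s"
| WhileTrue: "aval e s \<noteq> 0 \<Longrightarrow> exec c s t s' \<Longrightarrow> exec (While e c) s' t' s'' \<Longrightarrow>
    exec (While e c) s (1 + acost e s + t + t') s''"

inductive_cases exec_SkipE: "exec Skip s t s'"
inductive_cases exec_AssignE: "exec (Assign i e) s t s'"
inductive_cases exec_StoreE: "exec (Store a e) s t s'"
inductive_cases exec_SeqE: "exec (Seq c d) s t s'"
inductive_cases exec_IfE: "exec (If e c d) s t s'"
inductive_cases exec_WhileE: "exec (While e c) s t s'"

lemma exec_deterministic:
  "exec c s t s' \<Longrightarrow> exec c s u s'' \<Longrightarrow> u = t \<and> s'' = s'"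
proof (induction arbitrary: u s'' rule: exec.induct)
  case (Seq c s t s' d t' s2)
  from Seq.prems obtain v v' r where "exec c s v r" "exec d r v' s''" "u = v + v'"
    by (rule exec_SeqE)
  with Seq.IH(1)[of v r] Seq.IH(2)[of v' s''] show ?case by simp
next
  case (IfTrue e s c t s' d)
  from IfTrue.prems obtain v where "exec c s v s''" "u = 1 + acost e s + v"
    by (rule exec_IfE) (use IfTrue.hyps in simp_all)
  with IfTrue.IH[of v s''] show ?case by simp
next
  case (IfFalse e s d t s' c)
  from IfFalse.prems obtain v where "exec d s v s''" "u = 1 + acost e s + v"
    by (rule exec_IfE) (use IfFalse.hyps in simp_all)
  with IfFalse.IH[of v s''] show ?case by simp
next
  case (WhileTrue e s c t s' t' s2)
  from WhileTrue.prems obtain v v' r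
    where "exec c s v r" "exec (While e c) r v' s''" "u = 1 + acost e s + v + v'"
    by (rule exec_WhileE) (use WhileTrue.hyps in simp_all)
  with WhileTrue.IH(1)[of v r] WhileTrue.IH(2)[of v' s''] show ?case by simp
next
  case (WhileFalse e s c)
  from WhileFalse.prems show ?case by (rule exec_WhileE) (use WhileFalse.hyps in simp_all)
next
  case (Skip s)
  then show ?case by (rule exec_SkipE) simp
next
  case (Assign i e s)
  then show ?case by (rule exec_AssignE) simp
next
  case (Store a e s)
  then show ?case by (rule exec_StoreE) simp
qed

text \<open>
  A word of natural numbers is passed in memory with its length in cell 0 and its entries in
  cells 1, 2, and so on.  Initially all registers and all other cells are zero.
\<close>

definition initial_state :: "nat list \<Rightarrow> state" where
  "initial_state xs =
    (\<lambda>_. 0, \<lambda>i. if i = 0 then length xs else if i \<le> length xs then xs ! (i - 1) else 0)"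

definition output_word :: "state \<Rightarrow> nat list" where
  "output_word s = map (snd s) [1..<Suc (snd s 0)]"

definition input_size :: "nat list \<Rightarrow> nat" where
  "input_size xs = (\<Sum>x\<leftarrow>xs. bit_length x)"

definition outputs_within :: "com \<Rightarrow> nat list \<Rightarrow> nat \<Rightarrow> nat list \<Rightarrow> bool" where
  "outputs_within c xs b ys \<longleftrightarrow>
    (\<exists>t s. exec c (initial_state xs) t s \<and> t \<le> b \<and> output_word s = ys)"


section \<open>Encoding of instances and solutions\<close>

text \<open>
  The symbols of the alphabet are natural numbers.  Every row is prefixed by its length, so that
  the size of an instance is at least its number of rows even when there are no columns.
\<close>

definition encode_instance :: "nat \<Rightarrow> nat row list \<Rightarrow> nat list" where
  "encode_instance k rows = k # length rows # concat (map (\<lambda>r. length r # r) rows)"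

text \<open>
  A partition of the listed rows is output as one label per row; two rows belong to the same
  group if and only if they carry the same label.
\<close>

definition labelled_group :: "'a row list \<Rightarrow> nat list \<Rightarrow> nat \<Rightarrow> 'a row multiset" where
  "labelled_group rows labels l =
    image_mset (\<lambda>i. rows ! i) (mset_set {i. i < length rows \<and> labels ! i = l})"

definition decode_partition :: "'a row list \<Rightarrow> nat list \<Rightarrow> 'a row multiset multiset" where
  "decode_partition rows labels =
    image_mset (labelled_group rows labels) (mset_set (set labels))"

end

theory Submission
  imports Defs
begin

text \<open>
  A group costs nothing if its rows are equal; otherwise it costs between one and \<open>m\<close> per row.
  Hence it suffices to minimise the number of rows outside groups of equal rows, and all these rows
  may be merged into one residual group.  This group must contain the \<open>s\<close> rows whose class of equal
  rows has fewer than \<open>k\<close> members, which is optimal if \<open>s = 0\<close> or \<open>s \<ge> k\<close>.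
  Otherwise \<open>k\<close> rows are needed, and they suffice if the larger classes have together at least
  \<open>k - s\<close> rows in excess of \<open>k\<close> each; if they have not, one of these classes must be dissolved
  entirely, and dissolving a smallest one is enough.
\<close>

section \<open>Bounding logarithmic cost by the number of steps\<close>

text \<open>Minimality and running time need different arguments. A partition enters the lower bound
  only through the rows it puts into constant groups and the remaining rows, so minimality becomes a
  statement about two multisets \<open>H\<close> and \<open>U\<close>. For the time bound, the
  obstacle is that logarithmic cost charges for the lengths of numbers, and repeated squaring
  doubles these lengths at every step; a bound on the number of steps alone is therefore not enough.
  The program never stores a product: the only products stand in addresses. Lengths then grow at
  most linearly in the number of steps, and a polynomial step bound yields a polynomial cost bound.
  Correctness and step count are proved together in a Hoare-style calculus. The quantities of the
  combinatorial argument are defined by recursion over prefixes of the table, so that the same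
  functions serve as loop invariants.\<close>

lemma bit_length_le_iff: "bit_length x \<le> b \<longleftrightarrow> 0 < b \<and> x < 2 ^ b"
proof (cases "x = 0")
  case False
  then have "bit_length x \<le> b \<longleftrightarrow> floor_log x < b"
    by (simp add: bit_length_def Suc_le_eq)
  also have "\<dots> \<longleftrightarrow> x < 2 ^ b"
  proof
    assume "floor_log x < b"
    then have "2 * 2 ^ floor_log x \<le> (2 ^ b :: nat)"
      by (metis Suc_leI one_le_numeral power_Suc power_increasing)
    then show "x < 2 ^ b" using floor_log_exp2_gt[of x] by linarith
  next
    assume "x < 2 ^ b"
    then have "2 ^ floor_log x < (2 ^ b :: nat)"
      by (rule le_less_trans[of _ x, rotated]) (use False floor_log_exp2_le[of x] in simp)
    then show "floor_log x < b" by (rule power_less_imp_less_exp[rotated]) simp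
  qed
  finally show ?thesis using False by (cases b) auto
qed (simp add: bit_length_def floor_log_zero Suc_le_eq)

lemma bit_length_pos: "0 < bit_length x"
  by (simp add: bit_length_def)

lemma less_two_power_bit_length: "x < 2 ^ bit_length x"
  using bit_length_le_iff by blast

lemma bit_length_mono: "x \<le> y \<Longrightarrow> bit_length x \<le> bit_length y"
  by (meson bit_length_le_iff le_less_trans less_two_power_bit_length bit_length_pos)

lemma bit_length_le_Suc: "bit_length x \<le> Suc x"
  using less_exp[of "Suc x"] by (simp add: bit_length_le_iff del: less_exp)

lemma bit_length_add: "bit_length (x + y) \<le> Suc (max (bit_length x) (bit_length y))"
proof -
  let ?b = "max (bit_length x) (bit_length y)"
  have "x < 2 ^ ?b" "y < 2 ^ ?b"
    using bit_length_le_iff[of x ?b] bit_length_le_iff[of y ?b] by simp_all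
  then show ?thesis unfolding bit_length_le_iff by simp
qed

lemma bit_length_mult: "bit_length (x * y) \<le> bit_length x + bit_length y"
  using less_two_power_bit_length[of x] less_two_power_bit_length[of y] bit_length_pos[of x]
  by (simp add: bit_length_le_iff power_add mult_strict_mono)

section \<open>Growth of stored numbers and cost of expressions\<close>

text \<open>One bound for all registers and cells, so that reading memory needs no information about
  the address.\<close>

definition fits :: "nat \<Rightarrow> state \<Rightarrow> bool" where
  "fits W s \<longleftrightarrow> (\<forall>i. bit_length (fst s i) \<le> W \<and> bit_length (snd s i) \<le> W)"

text \<open>One syntactic constant serves three estimates: the length of a value, the additive
  growth of linear expressions, and the cost. The factor 2 at binary operations pays for the length
  of the result on top of the operands.\<close>

primrec aexp_weight :: "aexp \<Rightarrow> nat" where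
  "aexp_weight (Const n) = Suc n"
| "aexp_weight (Reg i) = 1"
| "aexp_weight (Mem a) = Suc (aexp_weight a)"
| "aexp_weight (Add a b) = 2 * (aexp_weight a + aexp_weight b)"
| "aexp_weight (Sub a b) = 2 * (aexp_weight a + aexp_weight b)"
| "aexp_weight (Mult a b) = 2 * (aexp_weight a + aexp_weight b)"

text \<open>
  Without products, a single step lengthens the stored numbers by at most a constant number of
  bits.  Products are harmless inside addresses, since what is read is bounded by the memory
  contents.
\<close>

primrec linear_aexp :: "aexp \<Rightarrow> bool" where
  "linear_aexp (Const n) \<longleftrightarrow> True"
| "linear_aexp (Reg i) \<longleftrightarrow> True"
| "linear_aexp (Mem a) \<longleftrightarrow> True"
| "linear_aexp (Add a b) \<longleftrightarrow> linear_aexp a \<and> linear_aexp b"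
| "linear_aexp (Sub a b) \<longleftrightarrow> linear_aexp a \<and> linear_aexp b"
| "linear_aexp (Mult a b) \<longleftrightarrow> False"

text \<open>Maxima over subcommands, because the weight bounds the contribution of a single step;
  \<open>Store\<close> adds, as it evaluates two expressions in one step.\<close>

primrec com_weight :: "com \<Rightarrow> nat" where
  "com_weight Skip = 0"
| "com_weight (Assign i e) = aexp_weight e"
| "com_weight (Store a e) = aexp_weight a + aexp_weight e"
| "com_weight (Seq c d) = max (com_weight c) (com_weight d)"
| "com_weight (If e c d) = max (aexp_weight e) (max (com_weight c) (com_weight d))"
| "com_weight (While e c) = max (aexp_weight e) (com_weight c)"

text \<open>Only expressions whose value is stored are restricted. A product in a test or in the
  address of a \<open>Store\<close> is paid for once and leaves no trace in the lengths.\<close>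

primrec linear_com :: "com \<Rightarrow> bool" where
  "linear_com Skip \<longleftrightarrow> True"
| "linear_com (Assign i e) \<longleftrightarrow> linear_aexp e"
| "linear_com (Store a e) \<longleftrightarrow> linear_aexp e"
| "linear_com (Seq c d) \<longleftrightarrow> linear_com c \<and> linear_com d"
| "linear_com (If e c d) \<longleftrightarrow> linear_com c \<and> linear_com d"
| "linear_com (While e c) \<longleftrightarrow> linear_com c"

lemma aexp_weight_pos: "0 < aexp_weight e"
  by (induction e) auto

lemma bit_length_aval_le:
  assumes "fits W s"
  shows "bit_length (aval e s) \<le> aexp_weight e * Suc W"
proof (induction e)
  case (Const n)
  show ?case using bit_length_le_Suc[of n] by (simp add: trans_le_add1)
next
  case (Reg i)
  show ?case using assms by (simp add: fits_def le_SucI)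
next
  case (Mem e)
  have "bit_length (aval (Mem e) s) \<le> W" using assms by (simp add: fits_def)
  then show ?case by simp
next
  case (Add a b)
  then show ?case
    using bit_length_add[of "aval a s" "aval b s"] bit_length_pos[of "aval a s"]
      bit_length_pos[of "aval b s"]
    by (simp add: algebra_simps)
next
  case (Sub a b)
  then show ?case
    using bit_length_mono[of "aval a s - aval b s" "aval a s"] by (simp add: algebra_simps)
next
  case (Mult a b)
  then show ?case
    using bit_length_mult[of "aval a s" "aval b s"] by (simp add: algebra_simps)
qed

text \<open>The growth is additive, so \<open>u\<close> steps lead to at most
  \<open>W + K * u\<close> bits; iterating the multiplicative bound
  \<open>bit_length_aval_le\<close> would give an exponential.\<close>

lemma bit_length_aval_linear:
  assumes "fits W s" "linear_aexp e"
  shows "bit_length (aval e s) \<le> W + aexp_weight e"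
  using assms(2)
proof (induction e)
  case (Const n)
  show ?case using bit_length_le_Suc[of n] by simp
next
  case (Reg i)
  show ?case using assms by (simp add: fits_def le_SucI)
next
  case (Mem e)
  show ?case using assms by (simp add: fits_def trans_le_add1 le_SucI)
next
  case (Add a b)
  then show ?case
    using bit_length_add[of "aval a s" "aval b s"] aexp_weight_pos[of a] aexp_weight_pos[of b]
    by simp
next
  case (Sub a b)
  then show ?case
    using bit_length_mono[of "aval a s - aval b s" "aval a s"] by simp
qed simp

lemma acost_le:
  assumes "fits W s"
  shows "acost e s \<le> aexp_weight e * Suc W"
proof (induction e)
  case (Const n)
  show ?case using bit_length_le_Suc[of n] by (simp add: trans_le_add1)
next
  case (Reg i)
  show ?case using assms by (simp add: fits_def le_SucI)
next
  case (Mem e)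
  have "bit_length (aval (Mem e) s) \<le> Suc W" using assms by (simp add: fits_def le_SucI)
  with Mem show ?case by simp
next
  case (Add a b)
  then show ?case
    using bit_length_add[of "aval a s" "aval b s"] bit_length_aval_le[OF assms, of a]
      bit_length_aval_le[OF assms, of b] bit_length_pos[of "aval a s"] bit_length_pos[of "aval b s"]
    by (simp add: algebra_simps)
next
  case (Sub a b)
  then show ?case
    using bit_length_mono[of "aval a s - aval b s" "aval a s"] bit_length_aval_le[OF assms, of a]
    by (simp add: algebra_simps)
next
  case (Mult a b)
  then show ?case
    using bit_length_mult[of "aval a s" "aval b s"] bit_length_aval_le[OF assms, of a]
      bit_length_aval_le[OF assms, of b]
    by (simp add: algebra_simps)
qed

section \<open>A calculus for termination, correctness and step counts\<close>

lemma fits_mono: "fits V s \<Longrightarrow> V \<le> W \<Longrightarrow> fits W s"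
  unfolding fits_def by (meson order_trans)

text \<open>
  \<open>u\<close> counts executed commands and tests.  As numbers grow by at most \<open>K\<close> bits per step, a bound on
  the number of steps already bounds the logarithmic cost.
\<close>

definition runs_within :: "com \<Rightarrow> state \<Rightarrow> nat \<Rightarrow> (state \<Rightarrow> bool) \<Rightarrow> bool" where
  "runs_within c s u Q \<longleftrightarrow>
    (\<exists>t s'. exec c s t s' \<and> Q s' \<and>
      (linear_com c \<longrightarrow>
        (\<forall>K W. com_weight c \<le> K \<longrightarrow> fits W s \<longrightarrow>
          fits (W + K * u) s' \<and> t \<le> u * Suc (K * Suc (W + K * u)))))"

text \<open>The formula charges each of \<open>u\<close> steps for itself and for expressions of
  weight at most \<open>K\<close>, all at the length \<open>W + K * u\<close>, which bounds the
  numbers throughout the run.\<close>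

lemma step_cost_mono:
  fixes K W u v :: nat
  assumes "u \<le> v"
  shows "u * Suc (K * Suc (W + K * u)) \<le> v * Suc (K * Suc (W + K * v))"
  using assms by (intro mult_mono Suc_leI le_imp_less_Suc add_mono order_refl) auto

lemma runs_within_mono:
  assumes "runs_within c s u Q" "u \<le> v" "\<And>s'. Q s' \<Longrightarrow> Q' s'"
  shows "runs_within c s v Q'"
proof -
  obtain t s' where *: "exec c s t s'" "Q s'"
    "\<And>K W. linear_com c \<Longrightarrow> com_weight c \<le> K \<Longrightarrow> fits W s \<Longrightarrow>
          fits (W + K * u) s' \<and> t \<le> u * Suc (K * Suc (W + K * u))"
    using assms(1) unfolding runs_within_def by blast
  have "fits (W + K * v) s' \<and> t \<le> v * Suc (K * Suc (W + K * v))"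
    if "linear_com c" "com_weight c \<le> K" "fits W s" for K W
    using *(3)[OF that] step_cost_mono[OF assms(2), of K W] assms(2)
    by (auto elim!: fits_mono)
  with *(1,2) assms(3) show ?thesis unfolding runs_within_def by blast
qed

lemma runs_within_Skip: "Q s \<Longrightarrow> runs_within Skip s 1 Q"
  unfolding runs_within_def
  by (intro exI[of _ 1] exI[of _ s]) (use exec.Skip in \<open>auto elim: fits_mono\<close>)

lemma runs_within_Assign:
  assumes "Q ((fst s)(i := aval e s), snd s)"
  shows "runs_within (Assign i e) s 1 Q"
proof -
  have "fits (W + K) ((fst s)(i := aval e s), snd s) \<and> 1 + acost e s \<le> Suc (K * Suc (W + K))"
    if "linear_aexp e" "aexp_weight e \<le> K" "fits W s" for K W
  proof -
    have "(aexp_weight e) * Suc W \<le> K * Suc (W + K)"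
      using that(2) by (intro mult_mono) auto
    then have "1 + acost e s \<le> Suc (K * Suc (W + K))"
      using acost_le[OF that(3), of e] by linarith
    moreover have "fits (W + K) s"
      using that(3) by (rule fits_mono) simp
    moreover have "bit_length (aval e s) \<le> W + K"
      using bit_length_aval_linear[OF that(3,1)] that(2) by linarith
    ultimately show ?thesis by (simp add: fits_def)
  qed
  then have "linear_com (Assign i e) \<longrightarrow> (\<forall>K W. com_weight (Assign i e) \<le> K \<longrightarrow> fits W s \<longrightarrow>
      fits (W + K * 1) ((fst s)(i := aval e s), snd s) \<and> 1 + acost e s \<le> 1 * Suc (K * Suc (W + K * 1)))"
    by simp
  with assms exec.Assign[of i e s] show ?thesis
    unfolding runs_within_def by blast
qed

lemma runs_within_Store:
  assumes "Q (fst s, (snd s)(aval a s := aval e s))"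
  shows "runs_within (Store a e) s 1 Q"
proof -
  have "fits (W + K) (fst s, (snd s)(aval a s := aval e s)) \<and> 1 + acost a s + acost e s \<le> Suc (K * Suc (W + K))"
    if "linear_aexp e" "aexp_weight a + aexp_weight e \<le> K" "fits W s" for K W
  proof -
    have "(aexp_weight a + aexp_weight e) * Suc W \<le> K * Suc (W + K)"
      using that(2) by (intro mult_mono) auto
    then have "1 + acost a s + acost e s \<le> Suc (K * Suc (W + K))"
      using acost_le[OF that(3), of a] acost_le[OF that(3), of e]
      unfolding add_mult_distrib by linarith
    moreover have "fits (W + K) s"
      using that(3) by (rule fits_mono) simp
    moreover have "bit_length (aval e s) \<le> W + K"
      using bit_length_aval_linear[OF that(3,1)] that(2) by linarith
    ultimately show ?thesis by (simp add: fits_def)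
  qed
  then have "linear_com (Store a e) \<longrightarrow> (\<forall>K W. com_weight (Store a e) \<le> K \<longrightarrow> fits W s \<longrightarrow>
      fits (W + K * 1) (fst s, (snd s)(aval a s := aval e s)) \<and> 1 + acost a s + acost e s \<le> 1 * Suc (K * Suc (W + K * 1)))"
    by simp
  with assms exec.Store[of a e s] show ?thesis
    unfolding runs_within_def by blast
qed

text \<open>In continuation style, with the run of \<open>d\<close> as postcondition of
  \<open>c\<close>, intermediate states arise by unification and need not be named. The length bound
  passed on to \<open>d\<close> is \<open>W + K * u\<close>.\<close>

lemma runs_within_Seq:
  assumes "runs_within c s u (\<lambda>s'. runs_within d s' v Q)"
  shows "runs_within (Seq c d) s (u + v) Q"
proof -
  obtain t s' where c: "exec c s t s'" "runs_within d s' v Q"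
    "\<And>K W. linear_com c \<Longrightarrow> com_weight c \<le> K \<Longrightarrow> fits W s \<Longrightarrow>
          fits (W + K * u) s' \<and> t \<le> u * Suc (K * Suc (W + K * u))"
    using assms unfolding runs_within_def[of c] by blast
  obtain t' s'' where d: "exec d s' t' s''" "Q s''"
    "\<And>K W. linear_com d \<Longrightarrow> com_weight d \<le> K \<Longrightarrow> fits W s' \<Longrightarrow>
          fits (W + K * v) s'' \<and> t' \<le> v * Suc (K * Suc (W + K * v))"
    using c(2) unfolding runs_within_def by blast
  have "fits (W + K * (u + v)) s'' \<and> t + t' \<le> (u + v) * Suc (K * Suc (W + K * (u + v)))"
    if "linear_com (Seq c d)" "com_weight (Seq c d) \<le> K" "fits W s" for K W
  proof -
    have 1: "fits (W + K * u) s'" "t \<le> u * Suc (K * Suc (W + K * u))"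
      using c(3)[of K W] that by auto
    have 2: "fits (W + K * u + K * v) s''" "t' \<le> v * Suc (K * Suc (W + K * u + K * v))"
      using d(3)[of K "W + K * u"] that 1 by auto
    have "u * Suc (K * Suc (W + K * u)) \<le> u * Suc (K * Suc (W + K * (u + v)))"
      by (intro mult_mono Suc_leI le_imp_less_Suc add_mono order_refl) auto
    with 1 2 show ?thesis by (simp add: algebra_simps)
  qed
  with exec.Seq[OF c(1) d(1)] d(2) show ?thesis unfolding runs_within_def by blast
qed

lemma test_cost:
  assumes "fits W s" "fits (W + K * u) s'" "t \<le> u * Suc (K * Suc (W + K * u))"
    and "aexp_weight e \<le> K"
  shows "fits (W + K * Suc u) s' \<and> 1 + acost e s + t \<le> Suc u * Suc (K * Suc (W + K * Suc u))"
proof -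
  have "aexp_weight e * Suc W \<le> K * Suc (W + K * Suc u)"
    using assms(4) by (intro mult_mono) auto
  then have "acost e s \<le> K * Suc (W + K * Suc u)"
    using acost_le[OF assms(1), of e] by linarith
  moreover have "u * Suc (K * Suc (W + K * u)) \<le> u * Suc (K * Suc (W + K * Suc u))"
    by (intro mult_mono Suc_leI le_imp_less_Suc add_mono order_refl) auto
  moreover have "fits (W + K * Suc u) s'"
    using assms(2) by (rule fits_mono) simp
  ultimately show ?thesis
    using assms(3) unfolding mult_Suc by linarith
qed

text \<open>Adding the bounds of both branches instead of taking their maximum keeps step counts
  plain sums; all branches in the program have constant bounds.\<close>

lemma runs_within_If:
  assumes "aval e s \<noteq> 0 \<Longrightarrow> runs_within c s u Q" "aval e s = 0 \<Longrightarrow> runs_within d s v Q"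
  shows "runs_within (If e c d) s (Suc (u + v)) Q"
proof (cases "aval e s = 0")
  case False
  obtain t s' where c: "exec c s t s'" "Q s'"
    "\<And>K W. linear_com c \<Longrightarrow> com_weight c \<le> K \<Longrightarrow> fits W s \<Longrightarrow>
          fits (W + K * u) s' \<and> t \<le> u * Suc (K * Suc (W + K * u))"
    using assms(1)[OF False] unfolding runs_within_def by blast
  have "fits (W + K * Suc u) s' \<and> 1 + acost e s + t \<le> Suc u * Suc (K * Suc (W + K * Suc u))"
    if "linear_com (If e c d)" "com_weight (If e c d) \<le> K" "fits W s" for K W
    using c(3)[of K W] that by (intro test_cost) auto
  with exec.IfTrue[OF False c(1), of d] c(2) have "runs_within (If e c d) s (Suc u) Q"
    unfolding runs_within_def by blast
  then show ?thesis by (rule runs_within_mono) auto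
next
  case True
  obtain t s' where d: "exec d s t s'" "Q s'"
    "\<And>K W. linear_com d \<Longrightarrow> com_weight d \<le> K \<Longrightarrow> fits W s \<Longrightarrow>
          fits (W + K * v) s' \<and> t \<le> v * Suc (K * Suc (W + K * v))"
    using assms(2)[OF True] unfolding runs_within_def by blast
  have "fits (W + K * Suc v) s' \<and> 1 + acost e s + t \<le> Suc v * Suc (K * Suc (W + K * Suc v))"
    if "linear_com (If e c d)" "com_weight (If e c d) \<le> K" "fits W s" for K W
    using d(3)[of K W] that by (intro test_cost) auto
  with exec.IfFalse[OF True d(1), of c] d(2) have "runs_within (If e c d) s (Suc v) Q"
    unfolding runs_within_def by blast
  then show ?thesis by (rule runs_within_mono) auto
qed

lemma runs_within_While_False:
  assumes "aval e s = 0" "Q s"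
  shows "runs_within (While e c) s 1 Q"
proof -
  have "fits (W + K * 1) s \<and> 1 + acost e s \<le> 1 * Suc (K * Suc (W + K * 1))"
    if "com_weight (While e c) \<le> K" "fits W s" for K W
    using test_cost[of W s K 0 s 0 e] that by auto
  with exec.WhileFalse[OF assms(1)] assms(2) show ?thesis
    unfolding runs_within_def by blast
qed

lemma runs_within_While_True:
  assumes "aval e s \<noteq> 0" "runs_within c s u (\<lambda>s'. runs_within (While e c) s' v Q)"
  shows "runs_within (While e c) s (Suc (u + v)) Q"
proof -
  \<comment> \<open>After the successful test the loop behaves like this sequence, so the sequence
    rule supplies both bounds and only the test remains to be charged.\<close>
  obtain t s' where st: "exec (Seq c (While e c)) s t s'" "Q s'"
    "\<And>K W. linear_com (Seq c (While e c)) \<Longrightarrow> com_weight (Seq c (While e c)) \<le> K \<Longrightarrow>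
      fits W s \<Longrightarrow> fits (W + K * (u + v)) s' \<and> t \<le> (u + v) * Suc (K * Suc (W + K * (u + v)))"
    using runs_within_Seq[OF assms(2)] unfolding runs_within_def by blast
  obtain r t1 t2 where "exec c s t1 r" "exec (While e c) r t2 s'" "t = t1 + t2"
    using st(1) by (rule exec_SeqE)
  then have ex: "exec (While e c) s (1 + acost e s + t) s'"
    using exec.WhileTrue[OF assms(1)] by (metis add.assoc)
  have "fits (W + K * Suc (u + v)) s' \<and>
      1 + acost e s + t \<le> Suc (u + v) * Suc (K * Suc (W + K * Suc (u + v)))"
    if "linear_com (While e c)" "com_weight (While e c) \<le> K" "fits W s" for K W
    using st(3)[of K W] that by (intro test_cost) auto
  with ex st(2) show ?thesis unfolding runs_within_def by blast
qed

definition for_loop :: "nat \<Rightarrow> nat \<Rightarrow> com \<Rightarrow> com" where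
  "for_loop i h c = Seq (Assign i (Const 0))
    (While (Sub (Reg h) (Reg i)) (Seq c (Assign i (Add (Reg i) (Const 1)))))"

lemma linear_for_loop [simp]: "linear_com (for_loop i h c) \<longleftrightarrow> linear_com c"
  by (simp add: for_loop_def)

text \<open>Induction on the number \<open>d\<close> of remaining rounds. A round pays
  \<open>u\<close> for the body, one for the test and one for the increment; the final 2 is the
  initial assignment and the failing test. The truncated difference tested by the loop is nonzero
  exactly while the counter is below \<open>n\<close>.\<close>

lemma runs_within_for_loop:
  assumes init: "J 0 ((fst s)(i := 0), snd s)"
    and step: "\<And>a s. a < n \<Longrightarrow> J a s \<Longrightarrow>
      runs_within c s u (\<lambda>s'. J (Suc a) ((fst s')(i := Suc (fst s' i)), snd s'))"
    and regs: "\<And>a s. J a s \<Longrightarrow> fst s i = a \<and> fst s h = n"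
    and post: "\<And>s'. J n s' \<Longrightarrow> Q s'"
  shows "runs_within (for_loop i h c) s (n * (u + 2) + 2) Q"
proof -
  let ?b = "Seq c (Assign i (Add (Reg i) (Const 1)))"
  let ?w = "While (Sub (Reg h) (Reg i)) ?b"
  have loop: "runs_within ?w s (d * (u + 2) + 1) Q" if "J (n - d) s" "d \<le> n" for d s
    using that
  proof (induction d arbitrary: s)
    case 0
    then have "runs_within ?w s 1 Q"
      using regs[of n s] post[of s] by (intro runs_within_While_False) auto
    then show ?case by simp
  next
    case (Suc d)
    let ?a = "n - Suc d"
    have J: "J (Suc ?a) s' \<Longrightarrow> runs_within ?w s' (d * (u + 2) + 1) Q" for s'
      using Suc.IH[of s'] Suc.prems(2) by (simp add: Suc_diff_Suc)
    have "runs_within (Assign i (Add (Reg i) (Const 1))) s' 1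
        (\<lambda>s'. runs_within ?w s' (d * (u + 2) + 1) Q)"
      if "J (Suc ?a) ((fst s')(i := Suc (fst s' i)), snd s')" for s'
      by (rule runs_within_Assign, rule J) (use that in simp)
    then have "runs_within ?b s (u + 1) (\<lambda>s'. runs_within ?w s' (d * (u + 2) + 1) Q)"
      by (intro runs_within_Seq runs_within_mono[OF step[OF _ Suc.prems(1)] order_refl])
        (use Suc.prems(2) in auto)
    then have "runs_within ?w s (Suc (u + 1 + (d * (u + 2) + 1))) Q"
      using regs[OF Suc.prems(1)] Suc.prems(2) by (intro runs_within_While_True) auto
    then show ?case by (simp add: algebra_simps)
  qed
  have "runs_within ?w ((fst s)(i := 0), snd s) (n * (u + 2) + 1) Q"
    using init by (intro loop) auto
  then have "runs_within (for_loop i h c) s (1 + (n * (u + 2) + 1)) Q"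
    unfolding for_loop_def by (intro runs_within_Seq runs_within_Assign) simp
  then show ?thesis by simp
qed

section \<open>An optimal residual group\<close>

text \<open>Recursive rather than a cardinality, because the second equation is what one loop
  iteration does to a counting register.\<close>

primrec count_below :: "(nat \<Rightarrow> bool) \<Rightarrow> nat \<Rightarrow> nat" where
  "count_below P 0 = 0"
| "count_below P (Suc n) = count_below P n + (if P n then 1 else 0)"

text \<open>What a register starting at 0 holds after being overwritten at every hit; hence the
  default 0.\<close>

primrec last_below :: "(nat \<Rightarrow> bool) \<Rightarrow> nat \<Rightarrow> nat" where
  "last_below P 0 = 0"
| "last_below P (Suc n) = (if P n then n else last_below P n)"

lemma count_below_eq_card: "count_below P n = card {i. i < n \<and> P i}"
proof (induction n)
  case (Suc n)
  have "{i. i < Suc n \<and> P i} = (if P n then insert n {i. i < n \<and> P i} else {i. i < n \<and> P i})"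
    by (auto simp: less_Suc_eq)
  with Suc show ?case by simp
qed simp

lemma count_below_cong: "(\<And>i. i < n \<Longrightarrow> P i = Q i) \<Longrightarrow> count_below P n = count_below Q n"
  by (induction n) auto

lemma count_below_mono: "(\<And>i. i < n \<Longrightarrow> P i \<Longrightarrow> Q i) \<Longrightarrow> count_below P n \<le> count_below Q n"
  by (induction n) fastforce+

lemma count_below_disj:
  "(\<And>i. i < n \<Longrightarrow> \<not> (P i \<and> Q i)) \<Longrightarrow>
    count_below (\<lambda>i. P i \<or> Q i) n = count_below P n + count_below Q n"
  by (induction n) auto

lemma count_below_not: "count_below (\<lambda>i. \<not> P i) n = n - count_below P n"
proof -
  have "count_below (\<lambda>i. \<not> P i) n + count_below P n = n" by (induction n) auto
  then show ?thesis by linarith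
qed

lemma count_below_less: "i < n \<Longrightarrow> P i \<Longrightarrow> count_below P i < count_below P n"
proof (induction n)
  case (Suc n)
  then show ?case by (cases "i = n") auto
qed simp

text \<open>Greedy selection: a hit is taken as long as fewer than \<open>q\<close> hits precede it.
  This covers both the first copies of a row and the excess rows that fill the residual
  group.\<close>

lemma count_below_capped: "count_below (\<lambda>i. P i \<and> count_below P i < q) n = min q (count_below P n)"
  by (induction n) auto

lemma last_below_sat: "i < n \<Longrightarrow> P i \<Longrightarrow> P (last_below P n) \<and> last_below P n < n"
  by (induction n) (auto simp: less_Suc_eq)

section \<open>Classes of equal rows and the residual group\<close>

definition class_size :: "'a list \<Rightarrow> nat \<Rightarrow> nat" where
  "class_size rows i = count_below (\<lambda>j. rows ! j = rows ! i) (length rows)"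

definition class_rank :: "'a list \<Rightarrow> nat \<Rightarrow> nat" where
  "class_rank rows i = count_below (\<lambda>j. rows ! j = rows ! i) i"

definition class_rep :: "'a list \<Rightarrow> nat \<Rightarrow> nat" where
  "class_rep rows i = last_below (\<lambda>j. rows ! j = rows ! i) (length rows)"

definition num_small :: "nat \<Rightarrow> 'a list \<Rightarrow> nat \<Rightarrow> nat" where
  "num_small k rows a = count_below (\<lambda>i. class_size rows i < k) a"

text \<open>Ranks in a class of \<open>c\<close> members run from 0 to \<open>c - 1\<close>, so over
  the whole table the class contributes the truncated difference \<open>c - k\<close>, and a small
  class nothing.\<close>

definition num_excess :: "nat \<Rightarrow> 'a list \<Rightarrow> nat \<Rightarrow> nat" where
  "num_excess k rows a = count_below (\<lambda>i. k \<le> class_rank rows i) a"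

text \<open>
  Representatives are shifted by one, so that \<open>0\<close> can mean that no class with at least \<open>k\<close> members
  has been seen.
\<close>

primrec smallest_large :: "nat \<Rightarrow> 'a list \<Rightarrow> nat \<Rightarrow> nat \<times> nat" where
  "smallest_large k rows 0 = (Suc (length rows), 0)"
| "smallest_large k rows (Suc a) =
    (if k \<le> class_size rows a \<and> class_size rows a < fst (smallest_large k rows a)
     then (class_size rows a, Suc (class_rep rows a)) else smallest_large k rows a)"

text \<open>
  The rows labelled \<open>0\<close> form the residual group.  It contains every row of a class with fewer than
  \<open>k\<close> members.  If that makes it nonempty but too small, it is filled up to \<open>k\<close> rows with excess
  rows, those preceded by at least \<open>k\<close> copies of themselves, or, if there are too few of them, with
  a smallest class of at least \<open>k\<close> members.
\<close>

definition quota :: "nat \<Rightarrow> 'a list \<Rightarrow> nat" where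
  "quota k rows =
    (let s = num_small k rows (length rows)
     in if 0 < s \<and> k \<le> s + num_excess k rows (length rows) then k - s else 0)"

definition target :: "nat \<Rightarrow> 'a list \<Rightarrow> nat" where
  "target k rows =
    (let s = num_small k rows (length rows)
     in if 0 < s \<and> s + num_excess k rows (length rows) < k
        then snd (smallest_large k rows (length rows)) else 0)"

text \<open>\<open>num_excess k rows i\<close> counts the excess rows before \<open>i\<close>, so
  the quota is filled by the first excess rows and a single pass can decide each label. The shift by
  one reserves 0 for the residual group.\<close>

definition group_label :: "nat \<Rightarrow> 'a list \<Rightarrow> nat \<Rightarrow> nat" where
  "group_label k rows i =
    (if class_size rows i < k \<or> (k \<le> class_rank rows i \<and> num_excess k rows i < quota k rows) \<or>
        Suc (class_rep rows i) = target k rows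
     then 0 else Suc (class_rep rows i))"

definition group_labels :: "nat \<Rightarrow> 'a list \<Rightarrow> nat list" where
  "group_labels k rows = map (group_label k rows) [0..<length rows]"

lemma length_group_labels [simp]: "length (group_labels k rows) = length rows"
  by (simp add: group_labels_def)

definition num_residual :: "nat \<Rightarrow> 'a list \<Rightarrow> nat" where
  "num_residual k rows = count_below (\<lambda>i. group_label k rows i = 0) (length rows)"

lemma size_filter_mset_eq_count_below:
  "size (filter_mset p (mset rows)) = count_below (\<lambda>i. p (rows ! i)) (length rows)"
  unfolding count_below_eq_card mset_filter[symmetric] size_mset length_filter_conv_card ..

lemma count_mset_eq_count_below: "count (mset rows) v = count_below (\<lambda>j. rows ! j = v) (length rows)"
  using size_filter_mset_eq_count_below[of "\<lambda>x. x = v" rows]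
  by (simp add: filter_eq_replicate_mset)

lemma class_size_eq_count: "class_size rows i = count (mset rows) (rows ! i)"
  by (simp add: class_size_def count_mset_eq_count_below)

lemma class_size_cong: "rows ! i = rows ! j \<Longrightarrow> class_size rows i = class_size rows j"
  by (simp add: class_size_def)

lemma class_rank_less_size: "i < length rows \<Longrightarrow> class_rank rows i < class_size rows i"
  unfolding class_rank_def class_size_def by (rule count_below_less) auto

lemma class_rep_eq_iff:
  assumes "i < length rows" "j < length rows"
  shows "class_rep rows i = class_rep rows j \<longleftrightarrow> rows ! i = rows ! j"
proof
  have "rows ! class_rep rows i = rows ! i" "rows ! class_rep rows j = rows ! j"
    unfolding class_rep_def
    using last_below_sat[of i "length rows" "\<lambda>l. rows ! l = rows ! i"]
      last_below_sat[of j "length rows" "\<lambda>l. rows ! l = rows ! j"] assms by auto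
  then show "class_rep rows i = class_rep rows j \<Longrightarrow> rows ! i = rows ! j" by metis
qed (simp add: class_rep_def)

lemma count_below_class_rank:
  "count_below (\<lambda>j. rows ! j = v \<and> class_rank rows j < q) n =
    min q (count_below (\<lambda>j. rows ! j = v) n)"
proof -
  have "count_below (\<lambda>j. rows ! j = v \<and> class_rank rows j < q) n =
      count_below (\<lambda>j. rows ! j = v \<and> count_below (\<lambda>j. rows ! j = v) j < q) n"
    by (rule count_below_cong) (auto simp: class_rank_def)
  then show ?thesis by (simp add: count_below_capped)
qed

lemma smallest_large_cases:
  assumes "i < a" "k \<le> class_size rows i"
  obtains j where "j < a" "k \<le> class_size rows j"
    "smallest_large k rows a = (class_size rows j, Suc (class_rep rows j))"
    "\<And>i. i < a \<Longrightarrow> k \<le> class_size rows i \<Longrightarrow> class_size rows j \<le> class_size rows i"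
proof -
  let ?sz = "class_size rows" and ?best = "smallest_large k rows"
  let ?some = "\<lambda>a j. j < a \<and> k \<le> ?sz j \<and> ?best a = (?sz j, Suc (class_rep rows j)) \<and>
    (\<forall>i<a. k \<le> ?sz i \<longrightarrow> ?sz j \<le> ?sz i)"
  have "?best a = (Suc (length rows), 0) \<and> (\<forall>i<a. ?sz i < k) \<or> (\<exists>j. ?some a j)"
  proof (induction a)
    case (Suc a)
    \<comment> \<open>Hence the sentinel \<open>Suc (length rows)\<close> exceeds every class size,
      and the first class with at least \<open>k\<close> members is accepted.\<close>
    have le: "?sz a \<le> length rows"
      using size_mset[of rows] by (metis class_size_eq_count count_le_size)
    show ?case
    proof (cases "k \<le> ?sz a \<and> ?sz a < fst (?best a)")
      case True
      then have "?some (Suc a) a" using Suc by (auto simp: less_Suc_eq)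
      then show ?thesis by blast
    next
      case False
      from Suc show ?thesis
      proof
        assume "?best a = (Suc (length rows), 0) \<and> (\<forall>i<a. ?sz i < k)"
        with False le show ?thesis by (auto simp: less_Suc_eq)
      next
        assume "\<exists>j. ?some a j"
        then obtain j where "?some a j" ..
        with False have "?some (Suc a) j" by (auto simp: less_Suc_eq)
        then show ?thesis by blast
      qed
    qed
  qed simp
  moreover have "\<not> (\<forall>i<a. class_size rows i < k)"
    using assms by (auto simp: not_less)
  ultimately obtain j where "j < a" "k \<le> class_size rows j"
    "smallest_large k rows a = (class_size rows j, Suc (class_rep rows j))"
    "\<forall>i<a. k \<le> class_size rows i \<longrightarrow> class_size rows j \<le> class_size rows i"
    by blast
  then show ?thesis using that by blast
qed

lemma num_residual_cases:
  assumes "k \<le> length rows"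
  defines "s \<equiv> num_small k rows (length rows)" and "e \<equiv> num_excess k rows (length rows)"
  obtains "s = 0 \<or> k \<le> s" "num_residual k rows = s"
  | "0 < s" "s < k" "k \<le> s + e" "num_residual k rows = k"
  | i where "0 < s" "s + e < k" "i < length rows" "k \<le> class_size rows i"
      "\<And>j. j < length rows \<Longrightarrow> k \<le> class_size rows j \<Longrightarrow> class_size rows i \<le> class_size rows j"
      "num_residual k rows = s + class_size rows i"
proof -
  let ?n = "length rows"
  have small: "count_below (\<lambda>i. class_size rows i < k) ?n = s"
    by (simp add: s_def num_small_def)
  have disj: "\<not> (class_size rows i < k \<and> k \<le> class_rank rows i \<and> R)" if "i < ?n" for i R
    using class_rank_less_size[OF that] by simp
  consider "s = 0 \<or> k \<le> s" | "0 < s" "s < k" "k \<le> s + e" | "0 < s" "s + e < k"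
    by linarith
  then show ?thesis
  proof cases
    case 1
    then have "quota k rows = 0" "target k rows = 0"
      by (auto simp: quota_def target_def s_def Let_def)
    then have "num_residual k rows = s"
      by (simp add: num_residual_def group_label_def small)
    with 1 show ?thesis by (rule that(1))
  next
    case 2
    then have "quota k rows = k - s" "target k rows = 0"
      by (auto simp: quota_def target_def s_def e_def Let_def)
    then have "num_residual k rows = count_below (\<lambda>i. class_size rows i < k \<or>
        (k \<le> class_rank rows i \<and> num_excess k rows i < k - s)) ?n"
      by (simp add: num_residual_def group_label_def)
    also have "\<dots> = s + count_below (\<lambda>i. k \<le> class_rank rows i \<and> num_excess k rows i < k - s) ?n"
      using disj by (subst count_below_disj) (auto simp: small)
    also have "count_below (\<lambda>i. k \<le> class_rank rows i \<and> num_excess k rows i < k - s) ?n = min (k - s) e"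
      unfolding num_excess_def e_def by (rule count_below_capped)
    finally have "num_residual k rows = k" using 2 by simp
    with 2 show ?thesis by (rule that(2))
  next
    case 3
    \<comment> \<open>Otherwise all rows are small and \<open>s\<close> is the length of the table,
      which is at least \<open>k\<close>, against \<open>s + e < k\<close>.\<close>
    have "\<exists>i<?n. k \<le> class_size rows i"
    proof (rule ccontr)
      assume "\<not> ?thesis"
      then have "s = count_below (\<lambda>_. True) ?n"
        unfolding small[symmetric] by (intro count_below_cong) auto
      then have "s = ?n" by (simp add: count_below_eq_card)
      with 3 assms show False by simp
    qed
    then obtain j where j: "j < ?n" "k \<le> class_size rows j"
      "smallest_large k rows ?n = (class_size rows j, Suc (class_rep rows j))"
      "\<And>i. i < ?n \<Longrightarrow> k \<le> class_size rows i \<Longrightarrow> class_size rows j \<le> class_size rows i"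
      using smallest_large_cases[of _ ?n k rows] by blast
    have "quota k rows = 0" "target k rows = Suc (class_rep rows j)"
      using 3 j(3) by (auto simp: quota_def target_def s_def e_def Let_def)
    then have "num_residual k rows =
        count_below (\<lambda>i. class_size rows i < k \<or> class_rep rows i = class_rep rows j) ?n"
      by (simp add: num_residual_def group_label_def)
    also have "\<dots> = count_below (\<lambda>i. class_size rows i < k \<or> rows ! i = rows ! j) ?n"
      using j(1) by (intro count_below_cong) (simp add: class_rep_eq_iff)
    also have "\<dots> = s + class_size rows j"
      using j(2) by (subst count_below_disj)
        (auto simp: small class_size_def[of _ j] dest: class_size_cong)
    finally show ?thesis using 3 j that(3) by blast
  qed
qed

lemma num_residual_zero_or_ge: "k \<le> length rows \<Longrightarrow> num_residual k rows = 0 \<or> k \<le> num_residual k rows"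
  by (rule num_residual_cases[of k rows]) auto

lemma group_label_class_ge:
  assumes "i < length rows" "group_label k rows i \<noteq> 0"
  shows "k \<le> count_below (\<lambda>j. group_label k rows j = group_label k rows i) (length rows)"
proof -
  have i: "k \<le> class_size rows i" "Suc (class_rep rows i) \<noteq> target k rows"
    "group_label k rows i = Suc (class_rep rows i)"
    using assms(2) by (auto simp: group_label_def split: if_splits)
  have "k = count_below (\<lambda>j. rows ! j = rows ! i \<and> class_rank rows j < k) (length rows)"
    using i(1) by (simp add: count_below_class_rank class_size_def)
  also have "\<dots> \<le> count_below (\<lambda>j. group_label k rows j = group_label k rows i) (length rows)"
  proof (rule count_below_mono)
    fix j assume j: "j < length rows" "rows ! j = rows ! i \<and> class_rank rows j < k"
    then have "class_size rows j = class_size rows i" "class_rep rows j = class_rep rows i"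
      by (simp_all add: class_size_def class_rep_def)
    with i j show "group_label k rows j = group_label k rows i"
      by (simp add: group_label_def)
  qed
  finally show ?thesis .
qed

text \<open>\<open>H\<close> collects the rows in constant groups, \<open>U\<close> all others.
  Values of small classes cannot occur in \<open>H\<close>, so \<open>s\<close> rows lie in
  \<open>U\<close>. If \<open>s > 0\<close>, then \<open>U\<close> is nonempty and has at least
  \<open>k\<close> rows. When \<open>s + e < k\<close>, some large class must moreover avoid
  \<open>H\<close> and lie in \<open>U\<close> entirely.\<close>

lemma residual_minimal:
  assumes split: "mset rows = H + U" and k: "k \<le> length rows"
    and H: "\<And>v. v \<in># H \<Longrightarrow> k \<le> count H v" and U: "U = {#} \<or> k \<le> size U"
  shows "num_residual k rows \<le> size U"
proof -
  let ?T = "mset rows" and ?n = "length rows"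
  have U_if_small: "count ?T v = count U v" if "count ?T v < k \<or> count H v = 0" for v
  proof -
    have "v \<notin># H" using H[of v] that unfolding split by (force simp: count_eq_zero_iff)
    then show ?thesis by (simp add: split not_in_iff)
  qed
  \<comment> \<open>\<open>Q\<close> adds values absent from \<open>H\<close> to the small ones:
    none of them to bound \<open>s\<close>, the dissolved class in the last case.\<close>
  have le_U: "count_below (\<lambda>i. class_size rows i < k \<or> Q (rows ! i)) ?n \<le> size U"
    if "\<And>v. Q v \<Longrightarrow> count H v = 0" for Q
  proof -
    have "filter_mset (\<lambda>v. count ?T v < k \<or> Q v) ?T \<subseteq># U"
      using U_if_small that by (auto simp: subseteq_mset_def)
    then have "size (filter_mset (\<lambda>v. count ?T v < k \<or> Q v) ?T) \<le> size U"
      by (rule size_mset_mono)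
    then show ?thesis by (simp add: size_filter_mset_eq_count_below class_size_eq_count)
  qed
  have s: "num_small k rows ?n \<le> size U"
    using le_U[of "\<lambda>_. False"] by (simp add: num_small_def)
  show ?thesis using k
  proof (cases rule: num_residual_cases)
    case 1
    with s show ?thesis by simp
  next
    case 2
    with s U show ?thesis by auto
  next
    case (3 i)
    have "k \<le> size U" using s 3(1) U by auto
    have "\<exists>j<?n. k \<le> class_size rows j \<and> count H (rows ! j) = 0"
    proof (rule ccontr)
      assume neg: "\<not> ?thesis"
      \<comment> \<open>\<open>?G\<close> holds exactly \<open>k\<close> copies of each large row.
        If every large row occurred in \<open>H\<close>, then \<open>?G\<close> would be contained
        in \<open>H\<close>, leaving at most \<open>s + e < k\<close> rows for
        \<open>U\<close>.\<close>
      let ?I = "{j. j < ?n \<and> \<not> (class_size rows j < k \<or> k \<le> class_rank rows j)}"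
      let ?G = "image_mset (\<lambda>j. rows ! j) (mset_set ?I)"
      have "count ?G v \<le> count H v" for v
      proof (cases "count ?G v = 0")
        case False
        then obtain j where j: "j < ?n" "k \<le> class_size rows j" "v = rows ! j"
          unfolding count_eq_zero_iff by auto
        have "count ?G v = card {j \<in> ?I. rows ! j = v}"
          by (simp add: count_image_mset Int_def vimage_def conj_commute)
        also have "\<dots> \<le> card {j. j < ?n \<and> (rows ! j = v \<and> class_rank rows j < k)}"
          by (rule card_mono) auto
        also have "\<dots> \<le> k"
          unfolding count_below_eq_card[symmetric] count_below_class_rank by simp
        also have "k \<le> count H v"
          using neg j H[of v] by (auto simp: not_in_iff)
        finally show ?thesis .
      qed simp
      then have "size ?G \<le> size H" by (intro size_mset_mono) (simp add: subseteq_mset_def)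
      moreover have "size ?G = ?n - (num_small k rows ?n + num_excess k rows ?n)"
      proof -
        have "size ?G = count_below (\<lambda>j. \<not> (class_size rows j < k \<or> k \<le> class_rank rows j)) ?n"
          by (simp add: count_below_eq_card)
        also have "\<dots> = ?n - count_below (\<lambda>j. class_size rows j < k \<or> k \<le> class_rank rows j) ?n"
          by (rule count_below_not)
        also have "count_below (\<lambda>j. class_size rows j < k \<or> k \<le> class_rank rows j) ?n =
            num_small k rows ?n + num_excess k rows ?n"
          unfolding num_small_def num_excess_def
          using class_rank_less_size[of _ rows] by (intro count_below_disj) fastforce
        finally show ?thesis .
      qed
      moreover have "?n = size H + size U" using split by (metis size_mset size_union)
      ultimately show False using \<open>k \<le> size U\<close> 3(2) by linarith
    qed
    then obtain j where j: "j < ?n" "k \<le> class_size rows j" "count H (rows ! j) = 0" by blast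
    have "num_small k rows ?n + class_size rows j =
        count_below (\<lambda>i. class_size rows i < k \<or> rows ! i = rows ! j) ?n"
      unfolding num_small_def using j(2) by (subst count_below_disj)
        (auto simp: class_size_def[of _ j] dest: class_size_cong)
    also have "\<dots> \<le> size U"
      using le_U[of "\<lambda>v. v = rows ! j"] j(3) by simp
    finally show ?thesis using 3(5)[OF j(1,2)] 3(6) by simp
  qed
qed

section \<open>Costs of partitions\<close>

lemma member_le_sum_mset: "M \<in># P \<Longrightarrow> M \<subseteq># \<Sum>\<^sub># P"
  by (auto dest!: multi_member_split)

lemma equal_rows_if_no_suppressed_column:
  assumes "suppressed_columns m M = {}" "r \<in># M" "r' \<in># M" "length r = m" "length r' = m"
  shows "r = r'"
proof (rule nth_equalityI)
  fix j assume "j < length r"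
  with assms(4) have "j < m" by simp
  moreover have "j \<notin> suppressed_columns m M" unfolding assms(1) by simp
  ultimately show "r ! j = r' ! j"
    using assms(2,3) unfolding suppressed_columns_def by blast
qed (simp add: assms)

lemma card_suppressed_columns_le: "card (suppressed_columns m M) \<le> m"
proof -
  have "card (suppressed_columns m M) \<le> card {..<m}"
    by (rule card_mono) (auto simp: suppressed_columns_def)
  then show ?thesis by simp
qed

text \<open>Groups without suppressed columns consist of copies of one row, so their union qualifies
  as \<open>H\<close>; every row of the other groups costs at least one.\<close>

lemma num_residual_le_partition_cost:
  assumes len: "\<forall>r\<in>set rows. length r = m" and k: "k \<le> length rows"
    and P: "k_anonymous_partition k (mset rows) P"
  shows "num_residual k rows \<le> partition_cost m P"
proof -
  let ?hom = "\<lambda>M. suppressed_columns m M = {}"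
  let ?PH = "filter_mset ?hom P" and ?PU = "filter_mset (\<lambda>M. \<not> ?hom M) P"
  have T: "\<Sum>\<^sub># P = mset rows" and ge: "\<And>M. M \<in># P \<Longrightarrow> k \<le> size M \<and> M \<noteq> {#}"
    using P by (auto simp: k_anonymous_partition_def table_partition_def)
  have split: "mset rows = \<Sum>\<^sub># ?PH + \<Sum>\<^sub># ?PU"
    unfolding T[symmetric] sum_mset.union[symmetric] multiset_partition[symmetric] ..
  have "num_residual k rows \<le> size (\<Sum>\<^sub># ?PU)"
  proof (rule residual_minimal[OF split k])
    fix v assume "v \<in># \<Sum>\<^sub># ?PH"
    then obtain M where M: "M \<in># ?PH" "v \<in># M" by auto
    have "set_mset M \<subseteq> set rows"
      using set_mset_mono[OF member_le_sum_mset[of M P]] M(1) T by simp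
    then have "\<forall>r\<in>#M. length r = m" using len by blast
    then have "\<forall>r\<in>#M. r = v"
      using equal_rows_if_no_suppressed_column[of m M _ v] M
      unfolding set_mset_filter mem_Collect_eq by blast
    then have "count M v = size M"
      by (induction M) auto
    moreover have "count M v \<le> count (\<Sum>\<^sub># ?PH) v"
      using member_le_sum_mset[OF M(1)] by (simp add: subseteq_mset_def)
    ultimately show "k \<le> count (\<Sum>\<^sub># ?PH) v" using ge[of M] M(1) by simp
  next
    show "\<Sum>\<^sub># ?PU = {#} \<or> k \<le> size (\<Sum>\<^sub># ?PU)"
    proof (cases "?PU = {#}")
      case True
      then show ?thesis unfolding True by simp
    next
      case False
      then obtain M where M: "M \<in># ?PU" by blast
      then have "size M \<le> size (\<Sum>\<^sub># ?PU)" by (intro size_mset_mono member_le_sum_mset)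
      with ge[of M] M show ?thesis by auto
    qed
  qed
  also have "size (\<Sum>\<^sub># ?PU) = (\<Sum>M\<in>#?PU. size M)"
    by (induction P) auto
  also have "\<dots> \<le> (\<Sum>M\<in>#?PU. group_cost m M)"
  proof (rule sum_mset_mono)
    fix M assume "M \<in># ?PU"
    then have "suppressed_columns m M \<noteq> {}" by simp
    moreover have "finite (suppressed_columns m M)" by (simp add: suppressed_columns_def)
    ultimately have "0 < card (suppressed_columns m M)" by (simp add: card_gt_0_iff)
    then show "size M \<le> group_cost m M" by (simp add: group_cost_def)
  qed
  also have "\<dots> \<le> partition_cost m P"
  proof -
    have "partition_cost m P = (\<Sum>M\<in>#?PH. group_cost m M) + (\<Sum>M\<in>#?PU. group_cost m M)"
      unfolding partition_cost_def
      by (metis image_mset_union multiset_partition sum_mset.union)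
    then show ?thesis by simp
  qed
  finally show ?thesis .
qed

section \<open>Validity and cost of the computed partition\<close>

lemma sum_mset_set_fibres:
  assumes "finite S" "finite A" "g ` A \<subseteq> S"
  shows "(\<Sum>l\<in>S. mset_set {i \<in> A. g i = l}) = mset_set A"
  using assms(2,3)
proof (induction A rule: finite_induct)
  case (insert x A)
  have "mset_set {i \<in> insert x A. g i = l} =
      mset_set {i \<in> A. g i = l} + (if l = g x then {#x#} else {#})" for l
  proof -
    have "{i \<in> insert x A. g i = l} =
        (if l = g x then insert x {i \<in> A. g i = l} else {i \<in> A. g i = l})" by auto
    with insert.hyps show ?thesis by simp
  qed
  with insert assms(1) show ?case by (simp add: sum.distrib)
qed simp

text \<open>The splitting is done on indices, since equal rows may carry different labels; the rows
  are substituted afterwards.\<close>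

lemma sum_decode_partition:
  assumes "length labels = length rows"
  shows "\<Sum>\<^sub># (decode_partition rows labels) = mset rows"
proof -
  have "\<Sum>\<^sub># (decode_partition rows labels) =
      (\<Sum>l\<in>set labels. image_mset ((!) rows) (mset_set {i \<in> {..<length rows}. labels ! i = l}))"
    by (simp add: decode_partition_def sum_unfold_sum_mset labelled_group_def[abs_def])
  also have "\<dots> = image_mset ((!) rows)
      (\<Sum>l\<in>set labels. mset_set {i \<in> {..<length rows}. labels ! i = l})"
    by (induction rule: finite_induct[OF finite_set[of labels]]) simp_all
  also have "\<dots> = image_mset ((!) rows) (mset_set {..<length rows})"
    using assms by (subst sum_mset_set_fibres) auto
  also have "\<dots> = mset rows"
    by (metis map_nth mset_map mset_upt atLeast0LessThan)
  finally show ?thesis .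
qed

lemma size_labelled_group:
  "size (labelled_group rows (group_labels k rows) l) =
    count_below (\<lambda>i. group_label k rows i = l) (length rows)"
proof -
  have "{i. i < length rows \<and> group_labels k rows ! i = l} =
      {i. i < length rows \<and> group_label k rows i = l}"
    by (auto simp: group_labels_def)
  then show ?thesis by (simp add: labelled_group_def count_below_eq_card)
qed

text \<open>Only labels that occur are decoded, so an empty residual group does not appear as a
  group.\<close>

lemma k_anonymous_group_labels:
  assumes "k \<le> length rows"
  shows "k_anonymous_partition k (mset rows) (decode_partition rows (group_labels k rows))"
proof -
  let ?L = "group_labels k rows"
  have "labelled_group rows ?L l \<noteq> {#} \<and> k \<le> size (labelled_group rows ?L l)" if l: "l \<in> set ?L" for l
  proof -
    obtain i where i: "i < length rows" "l = group_label k rows i"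
      using l by (auto simp: group_labels_def)
    have pos: "0 < count_below (\<lambda>j. group_label k rows j = l) (length rows)"
      using count_below_less[OF i(1), of "\<lambda>j. group_label k rows j = l"] i(2) by simp
    have "k \<le> count_below (\<lambda>j. group_label k rows j = l) (length rows)"
    proof (cases "l = 0")
      case True
      with num_residual_zero_or_ge[OF assms] pos show ?thesis by (simp add: num_residual_def)
    next
      case False
      with group_label_class_ge[OF i(1), of k] i(2) show ?thesis by simp
    qed
    with pos show ?thesis by (metis size_labelled_group size_empty less_irrefl)
  qed
  then show ?thesis
    unfolding k_anonymous_partition_def table_partition_def
    by (auto simp: sum_decode_partition) (auto simp: decode_partition_def)
qed

lemma partition_cost_group_labels:
  "partition_cost m (decode_partition rows (group_labels k rows)) \<le> m * num_residual k rows"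
proof -
  let ?L = "group_labels k rows" and ?g = "labelled_group rows (group_labels k rows)"
  have zero: "group_cost m (?g l) = 0" if "l \<noteq> 0" for l
  proof -
    have eq: "rows ! i = rows ! j"
      if "i < length rows" "j < length rows" "?L ! i = l" "?L ! j = l" for i j
    proof -
      from that \<open>l \<noteq> 0\<close> have "class_rep rows i = class_rep rows j"
        by (auto simp: group_labels_def group_label_def split: if_splits)
      with that show ?thesis by (simp add: class_rep_eq_iff)
    qed
    have "\<forall>r\<in>#?g l. \<forall>r'\<in>#?g l. r ! j = r' ! j" for j
      by (auto simp: labelled_group_def intro: arg_cong[OF eq, of _ _ "\<lambda>r. r ! j"])
    then have "suppressed_columns m (?g l) = {}"
      unfolding suppressed_columns_def by blast
    then show ?thesis by (simp add: group_cost_def)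
  qed
  have "partition_cost m (decode_partition rows ?L) = (\<Sum>l\<in>set ?L. group_cost m (?g l))"
    by (simp add: partition_cost_def decode_partition_def sum_unfold_sum_mset
        image_mset.compositionality o_def)
  \<comment> \<open>Only label 0 can contribute; if it does not occur, this merely adds a
    nonnegative term.\<close>
  also have "\<dots> \<le> (\<Sum>l\<in>{0}. group_cost m (?g l))"
  proof -
    have "(\<Sum>l\<in>set ?L. group_cost m (?g l)) = (\<Sum>l\<in>set ?L \<inter> {0}. group_cost m (?g l))"
      using zero by (intro sum.mono_neutral_right) auto
    also have "\<dots> \<le> (\<Sum>l\<in>{0}. group_cost m (?g l))"
      by (rule sum_mono2) auto
    finally show ?thesis .
  qed
  also have "\<dots> \<le> num_residual k rows * m"
    using card_suppressed_columns_le[of m "?g 0"]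
    by (simp add: group_cost_def size_labelled_group num_residual_def)
  finally show ?thesis by (simp add: mult.commute)
qed

section \<open>The program\<close>

abbreviation "rK \<equiv> Reg 0"
abbreviation "rN \<equiv> Reg 1"
abbreviation "rWidth \<equiv> Reg 2"
abbreviation "rBase \<equiv> Reg 3"
abbreviation "rSmall \<equiv> Reg 4"
abbreviation "rExcess \<equiv> Reg 5"
abbreviation "rBestSize \<equiv> Reg 6"
abbreviation "rBest \<equiv> Reg 7"
abbreviation "rI \<equiv> Reg 8"
abbreviation "rJ \<equiv> Reg 9"
abbreviation "rCol \<equiv> Reg 10"
abbreviation "rDiff \<equiv> Reg 11"
abbreviation "rRep \<equiv> Reg 12"
abbreviation "rSize \<equiv> Reg 13"
abbreviation "rRank \<equiv> Reg 14"
abbreviation "rQuota \<equiv> Reg 15"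
abbreviation "rTarget \<equiv> Reg 16"
abbreviation "rLabel \<equiv> Reg 17"

text \<open>Cells 0 to 2 hold the word length, \<open>k\<close> and the number of rows, so the table
  starts at cell 3. The width includes the length prefix of a row.\<close>

definition table_cell :: "aexp \<Rightarrow> aexp" where
  "table_cell r = Mem (Add (Const 3) (Add (Mult r rWidth) rCol))"

text \<open>Two truncated differences add up to the absolute difference, so \<open>rDiff\<close>
  stays 0 exactly as long as all compared cells agree.\<close>

definition compare_rows :: com where
  "compare_rows = Seq (Assign 11 (Const 0)) (for_loop 10 2
    (Assign 11 (Add rDiff (Add (Sub (table_cell rI) (table_cell rJ))
      (Sub (table_cell rJ) (table_cell rI))))))"

definition classify_row :: com where
  "classify_row = Seq (Assign 12 (Const 0)) (Seq (Assign 13 (Const 0)) (Seq (Assign 14 (Const 0))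
    (for_loop 9 1 (Seq compare_rows
      (If rDiff Skip
        (Seq (Assign 12 rJ) (Seq (Assign 13 (Add rSize (Const 1)))
          (If (Sub rI rJ) (Assign 14 (Add rRank (Const 1))) Skip))))))))"

text \<open>Adding one before the truncated subtraction turns the test for \<open><\<close> into one
  for \<open>\<le>\<close>: the stored excess flag is nonzero iff \<open>k\<close> is at most the
  rank.\<close>

definition record_row :: com where
  "record_row = Seq
    (If (Sub rK rSize)
      (Seq (Assign 4 (Add rSmall (Const 1))) (Store (Add rBase rI) (Const 0)))
      (Seq (Store (Add rBase rI) (Add rRep (Const 1)))
        (If (Sub rBestSize rSize) (Seq (Assign 6 rSize) (Assign 7 (Add rRep (Const 1)))) Skip)))
    (Seq (Store (Add (Add rBase rN) rI) (Sub (Add rRank (Const 1)) rK))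
      (If (Sub (Add rRank (Const 1)) rK) (Assign 5 (Add rExcess (Const 1))) Skip))"

text \<open>The width is read off the prefix of the first row; without rows, cell 3 is zero and the
  width is 1. Register 6 receives the sentinel of \<open>smallest_large\<close>.\<close>

definition read_header :: com where
  "read_header = Seq (Assign 0 (Mem (Const 1))) (Seq (Assign 1 (Mem (Const 2)))
    (Seq (Assign 2 (Add (Mem (Const 3)) (Const 1))) (Seq (Assign 3 (Add (Mem (Const 0)) (Const 1)))
      (Assign 6 (Add rN (Const 1))))))"

definition choose_residual :: com where
  "choose_residual = If rSmall
    (If (Sub (Add (Add rSmall rExcess) (Const 1)) rK)
      (Assign 15 (Sub rK rSmall)) (Assign 16 rBest)) Skip"

text \<open>With \<open>rTarget\<close> zero the comparison succeeds only for labels that are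
  already 0. Labels overwrite the input, which is no longer read, but not the two arrays behind
  it.\<close>

definition emit_label :: com where
  "emit_label = Seq (Assign 17 (Mem (Add rBase rI)))
    (Seq (If (Mem (Add (Add rBase rN) rI))
        (If rQuota (Seq (Assign 15 (Sub rQuota (Const 1))) (Assign 17 (Const 0))) Skip) Skip)
      (Seq (If (Add (Sub rLabel rTarget) (Sub rTarget rLabel)) Skip (Assign 17 (Const 0)))
        (Store (Add rI (Const 1)) rLabel)))"

definition anonymize :: com where
  "anonymize = Seq read_header (Seq (for_loop 8 1 (Seq classify_row record_row))
    (Seq choose_residual (Seq (for_loop 8 1 emit_label) (Store (Const 0) rN))))"

lemma linear_anonymize: "linear_com anonymize"
  by (simp add: anonymize_def read_header_def classify_row_def record_row_def choose_residual_def
      emit_label_def compare_rows_def table_cell_def)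

section \<open>Correctness and step counts of the program\<close>

lemmas runs_within_intros =
  runs_within_Seq runs_within_If runs_within_Assign runs_within_Store runs_within_Skip

text \<open>The accumulated difference and the final column counter are left unspecified: callers
  only ask whether the difference is zero.\<close>

lemma runs_within_compare_rows:
  assumes w: "fst s 2 = w"
    and Q: "\<And>d t. d = 0 \<longleftrightarrow> (\<forall>c<w. snd s (3 + (fst s 8 * w + c)) = snd s (3 + (fst s 9 * w + c))) \<Longrightarrow>
      Q ((fst s)(10 := t, 11 := d), snd s)"
  shows "runs_within compare_rows s (3 * w + 3) Q"
proof -
  let ?eq = "\<lambda>c. snd s (3 + (fst s 8 * w + c)) = snd s (3 + (fst s 9 * w + c))"
  let ?J = "\<lambda>a s'. \<exists>d. s' = ((fst s)(10 := a, 11 := d), snd s) \<and> (d = 0 \<longleftrightarrow> (\<forall>c<a. ?eq c))"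
  let ?body = "Assign 11 (Add rDiff (Add (Sub (table_cell rI) (table_cell rJ))
    (Sub (table_cell rJ) (table_cell rI))))"
  have "runs_within (for_loop 10 2 ?body) ((fst s)(11 := 0), snd s) (w * (1 + 2) + 2) Q"
  proof (rule runs_within_for_loop[where J = ?J])
    show "?J 0 ((fst ((fst s)(11 := 0), snd s))(10 := 0), snd ((fst s)(11 := 0), snd s))"
      by (auto simp: fun_eq_iff)
  next
    fix a s' assume "?J a s'"
    then obtain d where s': "s' = ((fst s)(10 := a, 11 := d), snd s)"
      and d: "d = 0 \<longleftrightarrow> (\<forall>c<a. ?eq c)"
      by blast
    show "runs_within ?body s' 1 (\<lambda>s''. ?J (Suc a) ((fst s'')(10 := Suc (fst s'' 10)), snd s''))"
      by (rule runs_within_Assign, rule exI, rule conjI)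
        (auto simp: s' d w table_cell_def fun_eq_iff less_Suc_eq)
  next
    fix s' assume "?J w s'"
    then obtain d where "s' = ((fst s)(10 := w, 11 := d), snd s)" "d = 0 \<longleftrightarrow> (\<forall>c<w. ?eq c)"
      by blast
    with Q[of d w] show "Q s'" by simp
  qed (use w in auto)
  then have "runs_within compare_rows s (1 + (w * (1 + 2) + 2)) Q"
    unfolding compare_rows_def by (intro runs_within_Seq runs_within_Assign) simp
  then show ?thesis by (rule runs_within_mono) simp_all
qed

lemma runs_within_classify_row:
  assumes regs: "fst s 1 = length rows" "fst s 2 = w" "fst s 8 = i" and i: "i < length rows"
    and cells: "\<And>a. a < length rows \<Longrightarrow>
      (\<forall>c<w. snd s (3 + (i * w + c)) = snd s (3 + (a * w + c))) \<longleftrightarrow> rows ! a = rows ! i"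
    and Q: "\<And>d t j. Q ((fst s)(9 := j, 10 := t, 11 := d, 12 := class_rep rows i,
      13 := class_size rows i, 14 := class_rank rows i), snd s)"
  shows "runs_within classify_row s (length rows * (3 * w + 12) + 5) Q"
proof -
  let ?n = "length rows" and ?P = "\<lambda>a. rows ! a = rows ! i"
  \<comment> \<open>Only rows before \<open>i\<close> count towards the rank, so register 14 stops
    growing at \<open>i\<close>; hence \<open>min a i\<close>.\<close>
  let ?J = "\<lambda>a s'. \<exists>t d. s' = ((fst s)(9 := a, 10 := t, 11 := d, 12 := last_below ?P a,
    13 := count_below ?P a, 14 := count_below ?P (min a i)), snd s)"
  let ?update = "If rDiff Skip
    (Seq (Assign 12 rJ) (Seq (Assign 13 (Add rSize (Const 1)))
      (If (Sub rI rJ) (Assign 14 (Add rRank (Const 1))) Skip)))"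
  let ?s0 = "((fst s)(12 := 0, 13 := 0, 14 := 0), snd s)"
  have "runs_within (for_loop 9 1 (Seq compare_rows ?update)) ?s0
    (?n * ((3 * w + 3 + Suc (1 + (1 + (1 + Suc (1 + 1))))) + 2) + 2) Q"
  proof (rule runs_within_for_loop[where J = ?J])
    show "?J 0 ((fst ?s0)(9 := 0), snd ?s0)"
      by (intro exI[of _ "fst s 10"] exI[of _ "fst s 11"]) (simp add: fun_eq_iff)
  next
    fix a s' assume a: "a < ?n" and "?J a s'"
    then obtain t d where s': "s' = ((fst s)(9 := a, 10 := t, 11 := d, 12 := last_below ?P a,
      13 := count_below ?P a, 14 := count_below ?P (min a i)), snd s)" by blast
    have min: "min (Suc a) i = (if a < i then Suc (min a i) else min a i)" "a < i \<Longrightarrow> min a i = a"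
      by auto
    show "runs_within (Seq compare_rows ?update) s' (3 * w + 3 + Suc (1 + (1 + (1 + Suc (1 + 1)))))
        (\<lambda>s''. ?J (Suc a) ((fst s'')(9 := Suc (fst s'' 9)), snd s''))"
    proof (rule runs_within_Seq, rule runs_within_compare_rows)
      fix d' t' :: nat
      assume "d' = 0 \<longleftrightarrow> (\<forall>c<w. snd s' (3 + (fst s' 8 * w + c)) = snd s' (3 + (fst s' 9 * w + c)))"
      then have d': "d' = 0 \<longleftrightarrow> ?P a" using cells[OF a] regs(3) by (simp add: s')
      show "runs_within ?update ((fst s')(10 := t', 11 := d'), snd s')
        (Suc (1 + (1 + (1 + Suc (1 + 1)))))
        (\<lambda>s''. ?J (Suc a) ((fst s'')(9 := Suc (fst s'' 9)), snd s''))"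
        by (intro runs_within_intros; rule exI[of _ t'], rule exI[of _ d'])
          (use d' regs(3) in \<open>simp_all add: s' fun_eq_iff min\<close>)
    qed (use regs s' in simp)
  next
    fix s' assume "?J ?n s'"
    then obtain t d where "s' = ((fst s)(9 := ?n, 10 := t, 11 := d, 12 := last_below ?P ?n,
      13 := count_below ?P ?n, 14 := count_below ?P (min ?n i)), snd s)" by blast
    moreover have "min ?n i = i" using i by simp
    ultimately show "Q s'"
      using Q[of ?n t d] by (simp add: class_rep_def class_size_def class_rank_def)
  qed (use regs in auto)
  then have "runs_within classify_row s (1 + (1 + (1 +
      (?n * ((3 * w + 3 + Suc (1 + (1 + (1 + Suc (1 + 1))))) + 2) + 2)))) Q"
    unfolding classify_row_def by (intro runs_within_Seq runs_within_Assign) simp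
  then show ?thesis by (rule runs_within_mono) simp_all
qed

text \<open>
  Behind the input, which ends before cell \<open>b\<close>, one array holds the tentative label of each row
  (\<open>0\<close> for members of small classes) and a second one flags the excess rows.
\<close>

definition recorded :: "nat \<Rightarrow> 'a list \<Rightarrow> nat \<Rightarrow> nat \<Rightarrow> (nat \<Rightarrow> nat) \<Rightarrow> bool" where
  "recorded k rows b a mem \<longleftrightarrow> (\<forall>i<a.
    mem (b + i) = (if class_size rows i < k then 0 else Suc (class_rep rows i)) \<and>
    (mem (b + length rows + i) \<noteq> 0 \<longleftrightarrow> k \<le> class_rank rows i))"

definition tallied :: "nat \<Rightarrow> 'a list \<Rightarrow> nat \<Rightarrow> (nat \<Rightarrow> nat) \<Rightarrow> bool" where
  "tallied k rows a reg \<longleftrightarrow> reg 4 = num_small k rows a \<and> reg 5 = num_excess k rows a \<and>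
    reg 6 = fst (smallest_large k rows a) \<and> reg 7 = snd (smallest_large k rows a)"

lemma runs_within_record_row:
  assumes regs: "fst s 0 = k" "fst s 1 = length rows" "fst s 3 = b" "fst s 8 = i"
      "fst s 12 = class_rep rows i" "fst s 13 = class_size rows i" "fst s 14 = class_rank rows i"
    and i: "i < length rows" and tal: "tallied k rows i (fst s)"
    and rec: "recorded k rows b i (snd s)"
    and Q: "\<And>reg mem. (\<And>x. x < b \<Longrightarrow> mem x = snd s x) \<Longrightarrow> recorded k rows b (Suc i) mem \<Longrightarrow>
      (\<And>r. r < 4 \<or> 7 < r \<Longrightarrow> reg r = fst s r) \<Longrightarrow> tallied k rows (Suc i) reg \<Longrightarrow> Q (reg, mem)"
  shows "runs_within record_row s 12 Q"
proof -
  \<comment> \<open>All branches end in this same memory, so one description serves every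
    path.\<close>
  let ?mem = "(snd s)(b + i := if class_size rows i < k then 0 else Suc (class_rep rows i),
    b + length rows + i := Suc (class_rank rows i) - k)"
  have rec': "recorded k rows b (Suc i) ?mem"
    using i rec by (auto simp: recorded_def less_Suc_eq)
  have Q': "Q (reg, mem)"
    if "mem = ?mem" "\<And>r. r < 4 \<or> 7 < r \<Longrightarrow> reg r = fst s r" "tallied k rows (Suc i) reg" for reg mem
    unfolding that(1) by (rule Q) (use that rec' in auto)
  have "runs_within record_row s (Suc (1 + 1 + (1 + Suc (1 + 1 + 1))) + (1 + Suc (1 + 1))) Q"
    unfolding record_row_def
    by (intro runs_within_intros; rule Q')
      (use tal regs in \<open>auto simp: tallied_def num_small_def num_excess_def\<close>)
  then show ?thesis by (rule runs_within_mono) simp_all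
qed

lemma runs_within_record_rows:
  assumes regs: "fst s 0 = k" "fst s 1 = length rows" "fst s 2 = w" "fst s 3 = b"
      "tallied k rows 0 (fst s)" "fst s 15 = 0" "fst s 16 = 0"
    and cells: "\<And>i a. i < length rows \<Longrightarrow> a < length rows \<Longrightarrow>
      (\<forall>c<w. snd s (3 + (i * w + c)) = snd s (3 + (a * w + c))) \<longleftrightarrow> rows ! a = rows ! i"
    and b: "length rows * w + 3 \<le> b"
    and Q: "\<And>reg mem. reg 0 = k \<Longrightarrow> reg 1 = length rows \<Longrightarrow> reg 3 = b \<Longrightarrow> reg 15 = 0 \<Longrightarrow> reg 16 = 0 \<Longrightarrow>
      tallied k rows (length rows) reg \<Longrightarrow> recorded k rows b (length rows) mem \<Longrightarrow> Q (reg, mem)"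
  shows "runs_within (for_loop 8 1 (Seq classify_row record_row)) s
    (length rows * (length rows * (3 * w + 12) + 5 + 12 + 2) + 2) Q"
proof -
  let ?n = "length rows"
  let ?J = "\<lambda>a (s' :: state). fst s' 0 = k \<and> fst s' 1 = ?n \<and> fst s' 2 = w \<and> fst s' 3 = b \<and> fst s' 8 = a \<and>
    fst s' 15 = 0 \<and> fst s' 16 = 0 \<and> tallied k rows a (fst s') \<and>
    recorded k rows b a (snd s') \<and> (\<forall>x<b. snd s' x = snd s x)"
  show ?thesis
  proof (rule runs_within_for_loop[where J = ?J])
    show "?J 0 ((fst s)(8 := 0), snd s)"
      using regs by (simp add: tallied_def recorded_def)
  next
    fix a s' assume a: "a < ?n" and J: "?J a s'"
    \<comment> \<open>The table lies below \<open>b\<close>, where nothing has been written.\<close>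
    have "snd s' (3 + (i * w + c)) = snd s (3 + (i * w + c))" if "i < ?n" "c < w" for i c
    proof -
      have "Suc i * w \<le> ?n * w" using that(1) by (intro mult_right_mono) auto
      with that(2) b have "3 + (i * w + c) < b" by simp
      with J show ?thesis by blast
    qed
    with cells[OF a] a have cells': "(\<forall>c<w. snd s' (3 + (a * w + c)) = snd s' (3 + (i * w + c)))
        \<longleftrightarrow> rows ! i = rows ! a" if "i < ?n" for i
      using that by simp
    show "runs_within (Seq classify_row record_row) s' (?n * (3 * w + 12) + 5 + 12)
      (\<lambda>s''. ?J (Suc a) ((fst s'')(8 := Suc (fst s'' 8)), snd s''))"
    proof (rule runs_within_Seq, rule runs_within_classify_row[OF _ _ _ a cells'])
      fix d t j :: nat
      let ?s = "((fst s')(9 := j, 10 := t, 11 := d, 12 := class_rep rows a,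
        13 := class_size rows a, 14 := class_rank rows a), snd s')"
      show "runs_within record_row ?s 12
        (\<lambda>s''. ?J (Suc a) ((fst s'')(8 := Suc (fst s'' 8)), snd s''))"
      proof (rule runs_within_record_row[where k = k and rows = rows and b = b and i = a])
        show "tallied k rows a (fst ?s)" using J by (simp add: tallied_def)
        fix reg :: "nat \<Rightarrow> nat" and mem :: "nat \<Rightarrow> nat"
        assume "\<And>x. x < b \<Longrightarrow> mem x = snd ?s x" "recorded k rows b (Suc a) mem"
          "\<And>r. r < 4 \<or> 7 < r \<Longrightarrow> reg r = fst ?s r" "tallied k rows (Suc a) reg"
        with J show "?J (Suc a) ((fst (reg, mem))(8 := Suc (fst (reg, mem) 8)), snd (reg, mem))"
          by (simp add: tallied_def)
      qed (use J a in auto)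
    qed (use J in auto)
  next
    fix s' assume "?J ?n s'"
    then show "Q s'" using Q[of "fst s'" "snd s'"] by simp
  qed auto
qed

lemma runs_within_choose_residual:
  assumes "fst s 0 = k" "fst s 15 = 0" "fst s 16 = 0" "tallied k rows (length rows) (fst s)"
    and Q: "Q ((fst s)(15 := quota k rows, 16 := target k rows), snd s)"
  shows "runs_within choose_residual s 6 Q"
proof -
  have Q': "Q (reg, mem)"
    if "mem = snd s" "reg = (fst s)(15 := quota k rows, 16 := target k rows)" for reg mem
    using that Q by simp
  have "runs_within choose_residual s (Suc (Suc (1 + 1) + 1)) Q"
    unfolding choose_residual_def
    by (intro runs_within_intros; (rule Q' | rule back_subst[of Q, OF Q]))
      (use assms in \<open>auto simp: tallied_def quota_def target_def Let_def fun_eq_iff prod_eq_iff\<close>)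
  then show ?thesis by (rule runs_within_mono) simp_all
qed

lemma runs_within_emit_labels:
  assumes regs: "fst s 1 = length rows" "fst s 3 = b" "fst s 15 = quota k rows"
      "fst s 16 = target k rows"
    and rec: "recorded k rows b (length rows) (snd s)" and b: "length rows < b"
    and Q: "\<And>reg mem. reg 1 = length rows \<Longrightarrow>
      (\<And>i. i < length rows \<Longrightarrow> mem (Suc i) = group_label k rows i) \<Longrightarrow> Q (reg, mem)"
  shows "runs_within (for_loop 8 1 emit_label) s (length rows * 15 + 2) Q"
proof -
  let ?n = "length rows"
  \<comment> \<open>By truncation, register 15 is nonzero exactly if fewer than
    \<open>quota k rows\<close> excess rows have been passed.\<close>
  let ?J = "\<lambda>a (s' :: state). fst s' 1 = ?n \<and> fst s' 3 = b \<and> fst s' 8 = a \<and>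
    fst s' 15 = quota k rows - num_excess k rows a \<and> fst s' 16 = target k rows \<and>
    recorded k rows b ?n (snd s') \<and> (\<forall>i<a. snd s' (Suc i) = group_label k rows i)"
  have "runs_within (for_loop 8 1 emit_label) s (?n * (13 + 2) + 2) Q"
  proof (rule runs_within_for_loop[where J = ?J])
    show "?J 0 ((fst s)(8 := 0), snd s)"
      using regs rec by (simp add: num_excess_def)
  next
    fix a s' assume a: "a < ?n" and J: "?J a s'"
    let ?Q = "\<lambda>s'' :: state. ?J (Suc a) ((fst s'')(8 := Suc (fst s'' 8)), snd s'')"
    \<comment> \<open>Labels go to cells up to \<open>?n < b\<close>, so both arrays
      survive.\<close>
    have rec: "recorded k rows b ?n ((snd s')(Suc a := y))" for y
      using a b J by (auto simp: recorded_def)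
    have Q': "?Q (reg, mem)"
      if "mem = (snd s')(Suc a := group_label k rows a)"
        "reg 15 = quota k rows - num_excess k rows (Suc a)"
        "reg 1 = ?n" "reg 3 = b" "reg 8 = a" "reg 16 = target k rows" for reg mem
      using J rec[of "group_label k rows a"] that by (auto simp: less_Suc_eq)
    have cells: "snd s' (b + a) = (if class_size rows a < k then 0 else Suc (class_rep rows a))"
      "0 < snd s' (b + ?n + a) \<longleftrightarrow> k \<le> class_rank rows a"
      using a J by (auto simp: recorded_def)
    have large: "k \<le> class_rank rows a \<Longrightarrow> k \<le> class_size rows a"
      using class_rank_less_size[OF a] by simp
    have ex: "num_excess k rows (Suc a) = num_excess k rows a + (if k \<le> class_rank rows a then 1 else 0)"
      by (simp add: num_excess_def)
    have "runs_within emit_label s' (1 + (Suc (Suc (1 + 1 + 1) + 1) + (Suc (1 + 1) + 1))) ?Q"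
      unfolding emit_label_def
      by (intro runs_within_intros; rule Q')
        (use J cells large in \<open>auto simp: fun_eq_iff ex group_label_def split: if_splits\<close>)
    then show "runs_within emit_label s' 13 ?Q" by (rule runs_within_mono) simp_all
  next
    fix s' assume "?J ?n s'"
    then show "Q s'" using Q[of "fst s'" "snd s'"] by simp
  qed auto
  then show ?thesis by (rule runs_within_mono) simp_all
qed

lemma length_concat_uniform:
  "\<forall>r\<in>set rows. length r = m \<Longrightarrow> length (concat (map (\<lambda>r. length r # r) rows)) = length rows * Suc m"
  by (induction rows) auto

lemma nth_concat_uniform:
  assumes "\<forall>r\<in>set rows. length r = m" "i < length rows" "c < Suc m"
  shows "concat (map (\<lambda>r. length r # r) rows) ! (i * Suc m + c) = (m # rows ! i) ! c"
  using assms(1,2)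
proof (induction rows arbitrary: i)
  case (Cons r rows)
  let ?c = "concat (map (\<lambda>r. length r # r) rows)"
  have app: "concat (map (\<lambda>r. length r # r) (r # rows)) = (m # r) @ ?c" and r: "length r = m"
    using Cons.prems by simp_all
  show ?case
  proof (cases i)
    case 0
    with assms(3) r show ?thesis unfolding app nth_append by simp
  next
    case (Suc i')
    with Cons.prems r Cons.IH[of i'] show ?thesis unfolding app nth_append by (simp add: add.assoc)
  qed
qed simp

text \<open>Per row, the two loops have an overhead of 19 and 15 steps, together 34. The remaining
  steps number 16, rounded up to 20.\<close>

lemma runs_within_anonymize:
  assumes k: "k \<le> length rows" and len: "\<forall>r\<in>set rows. length r = m"
    and s: "s = initial_state (encode_instance k rows)"
    and w: "w = (if rows = [] then 1 else Suc m)"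
  shows "runs_within anonymize s
    (length rows * (length rows * (3 * w + 12) + 34) + 20)
    (\<lambda>s'. output_word s' = group_labels k rows)"
proof -
  let ?n = "length rows" and ?xs = "encode_instance k rows"
  let ?b = "Suc (length ?xs)"
  have init: "fst s r = 0" "snd s 0 = length ?xs" "snd s (Suc 0) = k" "snd s 2 = ?n" for r
    by (simp_all add: s initial_state_def encode_instance_def)
  have len_xs: "length ?xs = ?n * w + 2"
    using len by (simp add: encode_instance_def length_concat_uniform[of _ m] w)
  have cell: "snd s (3 + (i * w + c)) = (m # rows ! i) ! c" if "i < ?n" "c < w" for i c
  proof -
    have "w = Suc m" using that w by auto
    have "Suc i * w \<le> ?n * w" using that(1) by (intro mult_right_mono) auto
    with that(2) have "3 + (i * w + c) \<le> length ?xs" by (simp add: len_xs)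
    then have "snd s (3 + (i * w + c)) = ?xs ! Suc (Suc (i * w + c))"
      unfolding s initial_state_def by simp
    with that \<open>w = Suc m\<close> len show ?thesis
      by (simp add: encode_instance_def nth_concat_uniform del: mult_Suc_right)
  qed
  have width: "Suc (snd s 3) = w"
  proof (cases "rows = []")
    case True
    then show ?thesis by (simp add: w s initial_state_def encode_instance_def)
  next
    case False
    with cell[of 0 0] show ?thesis by (simp add: w)
  qed
  have cells: "(\<forall>c<w. snd s (3 + (i * w + c)) = snd s (3 + (a * w + c))) \<longleftrightarrow> rows ! a = rows ! i"
    if "i < ?n" "a < ?n" for i a
  proof -
    have "w = Suc m" using that w by auto
    have "length (rows ! i) = m" "length (rows ! a) = m" using that len by auto
    then have "rows ! a = rows ! i \<longleftrightarrow> (\<forall>c<Suc m. (m # rows ! i) ! c = (m # rows ! a) ! c)"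
      by (auto simp: list_eq_iff_nth_eq All_less_Suc2)
    with cell[OF that(1)] cell[OF that(2)] \<open>w = Suc m\<close>[symmetric] show ?thesis by simp
  qed
  let ?s = "((fst s)(0 := k, 1 := ?n, 2 := w, 3 := ?b, 6 := Suc ?n), snd s)"
  let ?post = "\<lambda>s' :: state. output_word s' = group_labels k rows"
  have emit: "runs_within (Seq (for_loop 8 1 emit_label) (Store (Const 0) rN)) s'
      (?n * 15 + 2 + 1) ?post"
    if "fst s' 1 = ?n" "fst s' 3 = ?b" "fst s' 15 = quota k rows" "fst s' 16 = target k rows"
      "recorded k rows ?b ?n (snd s')" for s' :: state
  proof (rule runs_within_Seq, rule runs_within_emit_labels[OF that])
    show "?n < ?b" using len_xs w by simp
    fix reg mem :: "nat \<Rightarrow> nat"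
    assume "reg 1 = ?n" "\<And>i. i < ?n \<Longrightarrow> mem (Suc i) = group_label k rows i"
    then show "runs_within (Store (Const 0) rN) (reg, mem) 1 ?post"
      by (intro runs_within_Store)
        (simp add: output_word_def group_labels_def map_Suc_upt[symmetric] del: upt_Suc)
  qed
  have "runs_within (Seq (for_loop 8 1 (Seq classify_row record_row))
      (Seq choose_residual (Seq (for_loop 8 1 emit_label) (Store (Const 0) rN)))) ?s
      (?n * (?n * (3 * w + 12) + 5 + 12 + 2) + 2 + (6 + (?n * 15 + 2 + 1))) ?post"
  proof (rule runs_within_Seq, rule runs_within_record_rows[where b = ?b])
    fix reg mem :: "nat \<Rightarrow> nat"
    assume "reg 0 = k" "reg 1 = ?n" "reg 3 = ?b" "reg 15 = 0" "reg 16 = 0"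
      "tallied k rows ?n reg" "recorded k rows ?b ?n mem"
    then show "runs_within (Seq choose_residual
        (Seq (for_loop 8 1 emit_label) (Store (Const 0) rN))) (reg, mem) (6 + (?n * 15 + 2 + 1)) ?post"
      by (intro runs_within_Seq[OF runs_within_choose_residual[where k = k and rows = rows]] emit)
        auto
  qed (use cells in \<open>auto simp: init len_xs tallied_def num_small_def num_excess_def\<close>)
  moreover have "runs_within read_header s (1 + (1 + (1 + (1 + 1)))) (\<lambda>s'. s' = ?s)"
    unfolding read_header_def
    by (intro runs_within_intros) (simp add: init width fun_eq_iff)
  ultimately have "runs_within anonymize s ((1 + (1 + (1 + (1 + 1)))) +
      (?n * (?n * (3 * w + 12) + 5 + 12 + 2) + 2 + (6 + (?n * 15 + 2 + 1)))) ?post"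
    unfolding anonymize_def
    by (intro runs_within_Seq) (erule runs_within_mono, simp_all)
  then show ?thesis by (rule runs_within_mono) (simp_all add: algebra_simps)
qed

section \<open>The polynomial time bound\<close>

lemma length_le_input_size: "length xs \<le> input_size xs"
  by (induction xs) (auto simp: input_size_def bit_length_def)

text \<open>The successor accommodates cell 0, which holds the length of the word and is not itself
  an entry.\<close>

lemma fits_initial_state: "fits (Suc (input_size xs)) (initial_state xs)"
proof -
  have "bit_length x \<le> input_size xs" if "x \<in> set xs" for x
    unfolding input_size_def using that by (intro member_le_sum_list) auto
  moreover have "bit_length (length xs) \<le> Suc (input_size xs)"
    using bit_length_le_Suc[of "length xs"] length_le_input_size[of xs] by linarith
  moreover have "bit_length 0 \<le> Suc (input_size xs)"
    using bit_length_le_Suc[of 0] by simp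
  ultimately show ?thesis
    by (simp add: fits_def initial_state_def le_SucI)
qed

lemma anonymize_polynomial_time:
  "\<exists>p :: nat poly. \<forall>m k (rows :: nat row list).
    k \<le> length rows \<longrightarrow> (\<forall>r\<in>set rows. length r = m) \<longrightarrow>
    outputs_within anonymize (encode_instance k rows)
      (poly p (input_size (encode_instance k rows))) (group_labels k rows)"
proof -
  define K where "K = com_weight anonymize"
  \<comment> \<open>Since \<open>?n * w\<close> and \<open>?n\<close> are at most \<open>N\<close>,
    at most \<open>15 * N^2 + 34 * N + 20\<close> steps are made, which
    \<open>34 * (N + 1)^3\<close> dominates.\<close>
  define U :: "nat poly" where "U = [:34:] * [:1, 1:] ^ 3"
  \<comment> \<open>The cost formula of \<open>runs_within\<close> for \<open>W = Suc N\<close>;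
    \<open>[:2, 1:]\<close> is \<open>Suc (Suc N)\<close>.\<close>
  define p where "p = U * ([:1:] + [:K:] * ([:2, 1:] + [:K:] * U))"
  have "outputs_within anonymize (encode_instance k rows)
      (poly p (input_size (encode_instance k rows))) (group_labels k rows)"
    if k: "k \<le> length rows" and len: "\<forall>r\<in>set rows. length r = m"
    for m k and rows :: "nat row list"
  proof -
    let ?xs = "encode_instance k rows"
    define N where "N = input_size ?xs"
    define w where "w = (if rows = [] then 1 else Suc m)"
    let ?n = "length rows"
    have "?n * w + 2 = length ?xs"
      using len by (simp add: encode_instance_def length_concat_uniform[of _ m] w_def)
    then have nw: "?n * w + 2 \<le> N" using length_le_input_size[of ?xs] by (simp add: N_def)
    have "1 \<le> w" by (simp add: w_def)
    then have "?n \<le> ?n * w" by simp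
    with nw have n: "?n \<le> N" by linarith
    have "?n * (?n * (3 * w + 12) + 34) + 20 = 3 * (?n * (?n * w)) + 12 * (?n * ?n) + 34 * ?n + 20"
      by (simp add: algebra_simps)
    also have "\<dots> \<le> 3 * (N * N) + 12 * (N * N) + 34 * N + 20"
      using n nw by (intro add_mono mult_mono order_refl) auto
    also have "\<dots> \<le> 34 * Suc N ^ 3"
      by (simp add: power3_eq_cube algebra_simps)
    finally have u: "?n * (?n * (3 * w + 12) + 34) + 20 \<le> poly U N"
      by (simp add: U_def)
    have "runs_within anonymize (initial_state ?xs) (poly U N)
        (\<lambda>s'. output_word s' = group_labels k rows)"
      by (rule runs_within_mono[OF runs_within_anonymize[OF k len refl w_def] u])
    then obtain t s' where *: "exec anonymize (initial_state ?xs) t s'"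
      "output_word s' = group_labels k rows"
      "\<And>K W. linear_com anonymize \<Longrightarrow> com_weight anonymize \<le> K \<Longrightarrow> fits W (initial_state ?xs) \<Longrightarrow>
        fits (W + K * poly U N) s' \<and> t \<le> poly U N * Suc (K * Suc (W + K * poly U N))"
      unfolding runs_within_def by blast
    have "t \<le> poly U N * Suc (K * Suc (Suc N + K * poly U N))"
      using *(3)[OF linear_anonymize _ fits_initial_state, of K] by (simp add: K_def N_def)
    also have "\<dots> = poly p N" by (simp add: p_def)
    finally show ?thesis unfolding outputs_within_def N_def using *(1,2) by blast
  qed
  then show ?thesis by blast
qed

theorem theorem10:
  shows "\<exists>(algorithm :: com) (p :: nat poly).
    \<forall>(\<Sigma> :: nat set) m k (rows :: nat row list).
      table \<Sigma> m (mset rows) \<and> k \<le> length rows \<longrightarrow>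
      (\<exists>labels.
         outputs_within algorithm (encode_instance k rows)
           (poly p (input_size (encode_instance k rows))) labels \<and>
         length labels = length rows \<and>
         k_anonymous_partition k (mset rows) (decode_partition rows labels) \<and>
         partition_cost m (decode_partition rows labels) \<le> m * min_cost m k (mset rows))"
proof -
  obtain p :: "nat poly" where p: "\<And>m k (rows :: nat row list). k \<le> length rows \<Longrightarrow>
    \<forall>r\<in>set rows. length r = m \<Longrightarrow> outputs_within anonymize (encode_instance k rows)
      (poly p (input_size (encode_instance k rows))) (group_labels k rows)"
    using anonymize_polynomial_time by blast
  have "outputs_within anonymize (encode_instance k rows)
      (poly p (input_size (encode_instance k rows))) (group_labels k rows) \<and>
    length (group_labels k rows) = length rows \<and>
    k_anonymous_partition k (mset rows) (decode_partition rows (group_labels k rows)) \<and>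
    partition_cost m (decode_partition rows (group_labels k rows)) \<le> m * min_cost m k (mset rows)"
    if "table \<Sigma> m (mset rows)" and k: "k \<le> length rows"
    for \<Sigma> m k and rows :: "nat row list"
  proof (intro conjI)
    have len: "\<forall>r\<in>set rows. length r = m" using that(1) by (simp add: table_def)
    show "outputs_within anonymize (encode_instance k rows)
      (poly p (input_size (encode_instance k rows))) (group_labels k rows)"
      using p[OF k len] .
    obtain P where P: "k_anonymous_partition k (mset rows) P"
      "partition_cost m P = min_cost m k (mset rows)"
      using min_cost_attained[of k "mset rows" m] k by auto
    \<comment> \<open>The residual size links both sides: it bounds the minimum from below and,
      times \<open>m\<close>, the output from above.\<close>
    have "num_residual k rows \<le> min_cost m k (mset rows)"
      using num_residual_le_partition_cost[OF len k P(1)] P(2) by simp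
    then show "partition_cost m (decode_partition rows (group_labels k rows)) \<le>
        m * min_cost m k (mset rows)"
      by (intro order_trans[OF partition_cost_group_labels] mult_left_mono) simp_all
  qed (use k_anonymous_group_labels[OF k] in simp_all)
  then show ?thesis by blast
qed

end
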